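(* For $2\leq k\leq n$ let $\tau_{\mathrm{mix}}=\tau_{\mathrm{mix}}(n,k)$ be the mixing time of the bottom-to-top shuffle on $n$ cards in which the card moved to the top at each shuffle is chosen uniformly among the bottom $k$ cards. Let $k=k(n)$ and let $n\to\infty$. (i) If $k = o(n)$, then $$\tau_{\mathrm{mix}} \geq (1+o(1))\,\frac{n^3}{4\pi^2 k(k-1)}\log n .$$ (ii) If $k = \Theta(n)$, then $\tau_{\mathrm{mix}} = \Omega(n\log n)$.
   Context: Bottom-to-top shuffle with parameter $k$: the state space is the set $S_n$ of orderings of a deck of $n$ cards, with positions $1$ (top) to $n$ (bottom). At each time step, independently of the past, a position is chosen uniformly at random from $\{n-k+1,\ldots,n\}$ and the card in that position is moved to the top of the deck without altering the relative order of the other cards. The stationary distribution is the uniform distribution on $S_n$. Mixing time: with $\|\mu-\nu\|=\frac12\sum_s|\mu(s)-\nu(s)|$ and $\nu_{\mathrm{st}}$ the stationary distribution, $\tau_{\mathrm{mix}} := \max_s\min\{t : \|P(X_t\in\cdot\mid X_0=s)-\nu_{\mathrm{st}}\|\leq 1/4\}$. Asymptotic notation refers to $n\to\infty$ for a sequence $k=k(n)$; $\log$ is the natural logarithm and $\pi=3.14159\ldots$ in the claim. *)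

theory Defs
  imports
    "HOL-Probability.Probability"
    "HOL-Combinatorics.Combinatorics"
    "HOL-Library.Landau_Symbols"
begin

text \<open>
  An ordering of the deck is a list of the cards \<open>1, \<dots>, n\<close>, read from top to bottom;
  position \<open>i\<close> (counted from \<open>1\<close>) is list index \<open>i - 1\<close>.
\<close>

definition decks :: "nat \<Rightarrow> nat list set" where
  "decks n = permutations_of_set {1..n}"

definition move_to_top :: "nat \<Rightarrow> 'a list \<Rightarrow> 'a list" where
  "move_to_top i xs = xs ! (i - 1) # take (i - 1) xs @ drop i xs"

definition shuffle_step :: "nat \<Rightarrow> nat \<Rightarrow> nat list \<Rightarrow> nat list pmf" where
  "shuffle_step n k xs = map_pmf (\<lambda>i. move_to_top i xs) (pmf_of_set {n - k + 1..n})"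

text \<open>The law of \<open>X\<^sub>t\<close> given \<open>X\<^sub>0 = s\<close>.\<close>

primrec shuffle_law :: "nat \<Rightarrow> nat \<Rightarrow> nat list \<Rightarrow> nat \<Rightarrow> nat list pmf" where
  "shuffle_law n k s 0 = return_pmf s"
| "shuffle_law n k s (Suc t) = bind_pmf (shuffle_law n k s t) (shuffle_step n k)"

text \<open>\<open>S\<close> is the finite state space, assumed to carry both distributions.\<close>

definition tv_dist :: "'s set \<Rightarrow> 's pmf \<Rightarrow> 's pmf \<Rightarrow> real" where
  "tv_dist S \<mu> \<nu> = (\<Sum>s\<in>S. \<bar>pmf \<mu> s - pmf \<nu> s\<bar>) / 2"

text \<open>
  For \<open>2 \<le> k \<le> n\<close> the chain is irreducible and aperiodic with uniform stationary
  distribution, so that the minimum over \<open>t\<close> exists; outside this range the value has no meaning.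
\<close>

definition mixing_time :: "nat \<Rightarrow> nat \<Rightarrow> nat" where
  "mixing_time n k =
     Max ((\<lambda>s. LEAST t. tv_dist (decks n) (shuffle_law n k s t) (pmf_of_set (decks n)) \<le> 1 / 4)
            ` decks n)"

end

theory Submission
  imports Defs
begin

text \<open>
  Both bounds exhibit a statistic of the deck which the shuffle equilibrates slowly.

  For \<open>k = o(n)\<close> this is Wilson's method. A card outside the bottom \<open>k\<close> positions moves down by one
  at each step, and a card among them returns to the top with probability \<open>1 / k\<close>, wherever it
  stands there. So the times between visits of a fixed card to the top are independent copies of
  \<open>n - k + G\<close> with \<open>G\<close> geometric of parameter \<open>1 / k\<close>: their mean is \<open>n\<close> and their variance
  \<open>k (k - 1)\<close>. Accordingly \<open>\<zeta>\<close> raised to the number of cards above the given one, capped at \<open>n - k\<close>,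
  is an eigenfunction of its motion with eigenvalue \<open>\<zeta>\<close> as soon as
  \<open>\<zeta> ^ (n - k) (1 + k (\<zeta> - 1)) = 1\<close>, and near \<open>exp (2 \<pi> i / n)\<close> this equation has a root with
  \<open>- ln \<bar>\<zeta>\<bar>\<close> close to \<open>2 \<pi>\<^sup>2 k (k - 1) / n\<^sup>3\<close> (\<open>eigenvalue_exists\<close>). Summing the eigenfunction over
  all cards with coefficients of modulus one, chosen so that in the starting deck all terms are
  positive, gives a statistic \<open>\<Phi>\<close> of initial size of order \<open>n\<close>. One step changes the weight of just
  one randomly chosen card in an unpredictable way, so that \<open>\<Phi>\<close> keeps fluctuations of order at most
  \<open>sqrt n\<close> at all times and in equilibrium (\<open>wave_step\<close>, \<open>wilson_bound\<close>). As the mean of \<open>\<Phi>\<close> decays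
  like \<open>\<zeta> ^ t\<close>, it remains visible until \<open>\<bar>\<zeta>\<bar> ^ t\<close> is of order \<open>1 / sqrt n\<close>, which is the claimed time
  (\<open>mixing_time_ge_cubic\<close>).

  For \<open>k\<close> of order \<open>n\<close> a coupon collector argument is enough. The cards not yet moved form the bottom
  of the deck in their original order, and while \<open>u\<close> of them are left the next one is lost with
  probability at most \<open>u / k\<close>. So it takes about \<open>k ln n\<close> steps until fewer than two remain; before
  that the last two cards are in order, which in equilibrium has probability \<open>1 / 2\<close>
  (\<open>mixing_time_ge_k_log\<close>).

  Either argument bounds the times at which the distance is at most \<open>1 / 4\<close>. As the mixing time is
  defined by a least such time, one also has to know that such times exist, that is, that the chain
  converges (\<open>shuffle_converges\<close>).
\<close>

section \<open>Moves, reachable decks and stationarity\<close>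

lemma move_to_top_Cons: "move_to_top (Suc (length as)) (as @ a # bs) = a # as @ bs"
  by (simp add: move_to_top_def nth_append)

lemma split_at:
  assumes "1 \<le> i" "i \<le> length xs"
  obtains as a bs where "xs = as @ a # bs" "i = Suc (length as)"
proof -
  have "xs = take (i-1) xs @ xs ! (i-1) # drop i xs"
    using id_take_nth_drop[of "i-1" xs] assms by simp
  then show ?thesis using that[of "take (i-1) xs" "xs ! (i-1)" "drop i xs"] assms by simp
qed

lemma finite_decks [simp]: "finite (decks n)"
  by (simp add: decks_def)

lemma decks_nonempty [simp]: "decks n \<noteq> {}"
  by (simp add: decks_def permutations_of_set_empty_iff)

lemma decks_iff: "xs \<in> decks n \<longleftrightarrow> distinct xs \<and> set xs = {1..n}"
  by (auto simp: decks_def permutations_of_set_def)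

lemma length_decks: "xs \<in> decks n \<Longrightarrow> length xs = n"
  using distinct_card[of xs] by (auto simp: decks_iff)

lemma mset_decks: "xs \<in> decks n \<Longrightarrow> mset ys = mset xs \<Longrightarrow> ys \<in> decks n"
  by (metis decks_iff mset_eq_setD mset_eq_imp_distinct_iff)

lemma move_to_top_decks:
  assumes "xs \<in> decks n" "1 \<le> i" "i \<le> n"
  shows "move_to_top i xs \<in> decks n"
proof -
  obtain as a bs where "xs = as @ a # bs" "i = Suc (length as)"
    using split_at assms length_decks by metis
  then show ?thesis using mset_decks[OF assms(1)] by (simp add: move_to_top_Cons)
qed

lemma inj_on_move_to_top:
  assumes "1 \<le> i" "i \<le> n"
  shows "inj_on (move_to_top i) (decks n)"
proof (rule inj_onI)
  fix xs ys assume xs: "xs \<in> decks n" and ys: "ys \<in> decks n" and eq: "move_to_top i xs = move_to_top i ys"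
  obtain as a bs where 1: "xs = as @ a # bs" "i = Suc (length as)"
    using split_at assms length_decks[OF xs] by metis
  obtain as' a' bs' where 2: "ys = as' @ a' # bs'" "i = Suc (length as')"
    using split_at assms length_decks[OF ys] by metis
  have "a # as @ bs = a' # as' @ bs'"
    using eq 1 2 by (metis move_to_top_Cons)
  then show "xs = ys" using 1 2 by simp
qed

lemma bij_betw_move_to_top:
  assumes "1 \<le> i" "i \<le> n"
  shows "bij_betw (move_to_top i) (decks n) (decks n)"
  using inj_on_move_to_top[OF assms] move_to_top_decks[OF _ assms]
  by (intro endo_inj_surj[THEN bij_betw_imageI[rotated]]) auto

lemma set_pmf_shuffle_step:
  assumes "1 \<le> k"  "k \<le> n"
  shows "set_pmf (shuffle_step n k xs) = (\<lambda>i. move_to_top i xs) ` {n - k + 1..n}"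
  using assms by (simp add: shuffle_step_def set_pmf_of_set)

lemma set_pmf_law_subset:
  assumes "1 \<le> k"  "k \<le> n" "s \<in> decks n"
  shows "set_pmf (shuffle_law n k s t) \<subseteq> decks n"
  using assms by (induction t) (auto simp: set_pmf_shuffle_step intro!: move_to_top_decks)

lemma finite_set_pmf_law:
  assumes "1 \<le> k"  "k \<le> n" "s \<in> decks n"
  shows "finite (set_pmf (shuffle_law n k s t))"
  using finite_subset[OF set_pmf_law_subset[OF assms]] by simp

text \<open>
  For a fixed position the move permutes the decks, hence preserves the uniform distribution, and
  the step is a mixture of such moves.
\<close>

lemma uniform_stationary_step:
  assumes "1 \<le> k"  "k \<le> n"
  shows "bind_pmf (pmf_of_set (decks n)) (shuffle_step n k) = pmf_of_set (decks n)"
proof -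
  let ?J = "pmf_of_set {n - k + 1..n}" and ?u = "pmf_of_set (decks n)"
  have "bind_pmf ?u (shuffle_step n k) =
      bind_pmf ?u (\<lambda>xs. bind_pmf ?J (\<lambda>i. return_pmf (move_to_top i xs)))"
    by (intro bind_pmf_cong refl) (simp add: shuffle_step_def map_pmf_def)
  also have "\<dots> = bind_pmf ?J (\<lambda>i. map_pmf (move_to_top i) ?u)"
    by (subst bind_commute_pmf) (simp add: map_pmf_def)
  also have "\<dots> = bind_pmf ?J (\<lambda>i. ?u)"
  proof (intro bind_pmf_cong refl)
    fix i assume "i \<in> set_pmf ?J"
    then have "1 \<le> i" "i \<le> n" using assms by auto
    then show "map_pmf (move_to_top i) ?u = ?u"
      using map_pmf_of_set_bij_betw[OF bij_betw_move_to_top] by simp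
  qed
  also have "\<dots> = ?u" by simp
  finally show ?thesis .
qed

lemma shuffle_law_add:
  "shuffle_law n k s (t + r) = bind_pmf (shuffle_law n k s t) (\<lambda>x. shuffle_law n k x r)"
proof (induction r)
  case 0
  then show ?case by (simp add: bind_return_pmf')
next
  case (Suc r)
  then show ?case by (simp add: bind_assoc_pmf)
qed

lemma uniform_stationary:
  assumes "1 \<le> k"  "k \<le> n"
  shows "bind_pmf (pmf_of_set (decks n)) (\<lambda>x. shuffle_law n k x t) = pmf_of_set (decks n)"
proof (induction t)
  case 0
  then show ?case by (simp add: bind_return_pmf')
next
  case (Suc t)
  then show ?case
    by (simp add: bind_assoc_pmf[symmetric] uniform_stationary_step[OF assms])
qed

lemma swap_closed_move_front:
  assumes "\<And>as a b bs. as @ a # b # bs \<in> C \<Longrightarrow> as @ b # a # bs \<in> C"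
  shows "pre @ xs @ y # zs \<in> C \<Longrightarrow> pre @ y # xs @ zs \<in> C"
proof (induction xs arbitrary: zs rule: rev_induct)
  case (snoc x xs)
  then show ?case using assms[of "pre @ xs" x y zs] by simp
qed simp

text \<open>
  Bubble sort, carried out behind a fixed prefix: the required front card is brought forward by
  adjacent swaps and then joins the prefix.
\<close>

lemma swap_closed_mset:
  assumes "\<And>as a b bs. as @ a # b # bs \<in> C \<Longrightarrow> as @ b # a # bs \<in> C"
  shows "pre @ xs \<in> C \<Longrightarrow> mset ys = mset xs \<Longrightarrow> pre @ ys \<in> C"
proof (induction ys arbitrary: pre xs)
  case (Cons y ys)
  then have "y \<in> set xs" by (metis list.set_intros(1) mset_eq_setD)
  then obtain us vs where xs: "xs = us @ y # vs" by (meson split_list)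
  have "(pre @ [y]) @ (us @ vs) \<in> C"
    using swap_closed_move_front[of C pre us y vs] assms Cons.prems xs by simp
  moreover have "mset ys = mset (us @ vs)" using Cons.prems xs by simp
  ultimately show ?case using Cons.IH by fastforce
qed simp

lemma bounded_incseq_nat_eventually_const:
  fixes f :: "nat \<Rightarrow> nat"
  assumes "\<And>t. f t \<le> f (Suc t)" "\<And>t. f t \<le> B"
  obtains T where "\<And>t. T \<le> t \<Longrightarrow> f t = f T"
proof -
  have fin: "finite (range f)" using assms(2) by (intro finite_subset[of "range f" "{..B}"]) auto
  then have "Max (range f) \<in> range f" by (intro Max_in) auto
  then obtain T where T: "f T = Max (range f)" by (metis rangeE)
  have "f t = f T" if "T \<le> t" for t
    using lift_Suc_mono_le[of f T t] assms that T Max_ge[OF fin, of "f t"] by (simp add: le_antisym)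
  then show ?thesis using that by blast
qed

text \<open>
  The number of decks that can be reached in exactly \<open>t\<close> steps is nondecreasing, because every move is
  injective, so it is eventually constant. From then on each allowed move maps the decks reachable at time
  \<open>t\<close> onto those reachable at time \<open>t + 1\<close>, and moves can be undone within the reachable
  sets. Moving up the last card and undoing the move of the last but one swaps the last two cards;
  conjugating this with rotations of the deck gives all adjacent swaps. Because the argument follows
  exact times, it settles irreducibility and aperiodicity together.
\<close>

lemma law_full_support:
  assumes k: "2 \<le> k" "k \<le> n" and s: "s \<in> decks n"
  obtains T where "\<And>t. T \<le> t \<Longrightarrow> set_pmf (shuffle_law n k s t) = decks n"
proof -
  define R where "R t = set_pmf (shuffle_law n k s t)" for t
  have k': "1 \<le> k" using k by simp
  have sub: "R t \<subseteq> decks n" for t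
    unfolding R_def using set_pmf_law_subset[OF k' k(2) s] .
  have fin: "finite (R t)" for t using finite_subset[OF sub] by simp
  have inj: "inj_on (move_to_top i) (R t)" if "i \<in> {n - k + 1..n}" for i t
    using inj_on_subset[OF inj_on_move_to_top sub] that by auto
  have step: "move_to_top i ` R t \<subseteq> R (Suc t)" if "i \<in> {n - k + 1..n}" for i t
    using that by (auto simp: R_def set_pmf_shuffle_step[OF k' k(2)])
  have n: "n \<in> {n - k + 1..n}" and n1: "n - 1 \<in> {n - k + 1..n}" using k by auto
  have mono: "card (R t) \<le> card (R (Suc t))" for t
    using card_mono[OF fin step[OF n]] card_image[OF inj[OF n]] by simp
  obtain T where T: "\<And>t. T \<le> t \<Longrightarrow> card (R t) = card (R T)"
    using bounded_incseq_nat_eventually_const[of "\<lambda>t. card (R t)" "card (decks n)"]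
      mono card_mono[OF finite_decks sub] by blast
  have onto: "move_to_top i ` R t = R (Suc t)" if "T \<le> t" "i \<in> {n - k + 1..n}" for t i
  proof (rule card_subset_eq[OF fin step[OF that(2)]])
    show "card (move_to_top i ` R t) = card (R (Suc t))"
      using card_image[OF inj[OF that(2)]] T[of t] T[of "Suc t"] that by simp
  qed
  have pull: "ys \<in> R t"
    if "T \<le> t" "i \<in> {n - k + 1..n}" "ys \<in> decks n" "move_to_top i ys \<in> R (Suc t)" for t i ys
  proof -
    have "move_to_top i ys \<in> move_to_top i ` R t" using onto[OF that(1,2)] that(4) by simp
    then obtain zs where zs: "zs \<in> R t" "move_to_top i zs = move_to_top i ys"
      by auto
    moreover have "1 \<le> i" "i \<le> n" using that(2) by auto
    ultimately show ?thesis
      using inj_onD[OF inj_on_move_to_top[of i n], of zs ys] that(3) sub by auto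
  qed
  \<comment> \<open>Induction on the number of cards below the pair, at all late times simultaneously:
      rotating the deck once brings one card less below the pair, at the next time.\<close>
  have swap: "as @ b # a # bs \<in> R t" if "T \<le> t" "as @ a # b # bs \<in> R t" for as a b bs t
    using that
  proof (induction bs arbitrary: t as rule: rev_induct)
    case Nil
    have len: "length (as @ [a, b]) = n" using length_decks sub Nil by blast
    have D: "as @ [b, a] \<in> decks n" using mset_decks[OF subsetD[OF sub Nil(2)]] by simp
    have "move_to_top n (as @ [a, b]) \<in> R (Suc t)" using step[OF n] Nil by blast
    also have "move_to_top n (as @ [a, b]) = b # as @ [a]"
      using move_to_top_Cons[of "as @ [a]" b "[]"] len by simp
    also have "\<dots> = move_to_top (n - 1) (as @ [b, a])"
      using move_to_top_Cons[of as b "[a]"] len by (simp flip: len)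
    finally show ?case using pull[OF Nil(1) n1 D] by simp
  next
    case (snoc c bs)
    have len: "length (as @ a # b # bs @ [c]) = n" using length_decks sub snoc.prems by blast
    have D: "as @ b # a # bs @ [c] \<in> decks n"
      using mset_decks[OF subsetD[OF sub snoc.prems(2)]] by simp
    have "move_to_top n (as @ a # b # bs @ [c]) \<in> R (Suc t)" using step[OF n] snoc.prems by blast
    also have "move_to_top n (as @ a # b # bs @ [c]) = (c # as) @ a # b # bs"
      using move_to_top_Cons[of "as @ a # b # bs" c "[]"] len by simp
    finally have "(c # as) @ b # a # bs \<in> R (Suc t)"
      using snoc.IH[of "Suc t" "c # as"] snoc.prems by simp
    also have "(c # as) @ b # a # bs = move_to_top n (as @ b # a # bs @ [c])"
      using move_to_top_Cons[of "as @ b # a # bs" c "[]"] len by simp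
    finally show ?case using pull[OF snoc.prems(1) n D] by simp
  qed
  have "R t = decks n" if t: "T \<le> t" for t
  proof
    show "R t \<subseteq> decks n" by (rule sub)
    show "decks n \<subseteq> R t"
    proof
      fix ys assume ys: "ys \<in> decks n"
      obtain xs where xs: "xs \<in> R t" unfolding R_def using set_pmf_not_empty by fastforce
      then have "xs \<in> decks n" using sub by blast
      then have "mset ys = mset xs" using ys by (simp add: decks_iff set_eq_iff_mset_eq_distinct[symmetric])
      then show "ys \<in> R t"
        using swap_closed_mset[of "R t" "[]" xs ys] swap[OF t] xs by fastforce
    qed
  qed
  then show ?thesis using that R_def by blast
qed

section \<open>Total variation distance and convergence to equilibrium\<close>

lemma tv_prob_le:
  assumes "finite S" "set_pmf \<mu> \<subseteq> S" "set_pmf \<nu> \<subseteq> S"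
  shows "measure_pmf.prob \<mu> A - measure_pmf.prob \<nu> A \<le> tv_dist S \<mu> \<nu>"
proof -
  let ?d = "\<lambda>s. pmf \<mu> s - pmf \<nu> s"
  have pr: "measure_pmf.prob p A = (\<Sum>s\<in>S \<inter> A. pmf p s)" if "set_pmf p \<subseteq> S" for p
  proof -
    have "measure_pmf.prob p A = measure_pmf.prob p (S \<inter> A)"
      using that by (intro measure_pmf.finite_measure_eq_AE) (auto simp: AE_measure_pmf_iff)
    then show ?thesis using assms(1) by (simp add: measure_measure_pmf_finite)
  qed
  have "(\<Sum>s\<in>S. ?d s) = 0"
    using assms by (simp add: sum_subtractf sum_pmf_eq_1)
  moreover have "(\<Sum>s\<in>S. ?d s) = (\<Sum>s\<in>S \<inter> A. ?d s) + (\<Sum>s\<in>S - A. ?d s)"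
    using assms(1) by (metis sum.Int_Diff)
  moreover have "(\<Sum>s\<in>S. \<bar>?d s\<bar>) = (\<Sum>s\<in>S \<inter> A. \<bar>?d s\<bar>) + (\<Sum>s\<in>S - A. \<bar>?d s\<bar>)"
    using assms(1) by (metis sum.Int_Diff)
  moreover have "(\<Sum>s\<in>S \<inter> A. ?d s) \<le> (\<Sum>s\<in>S \<inter> A. \<bar>?d s\<bar>)" by (intro sum_mono) simp
  moreover have "- (\<Sum>s\<in>S - A. ?d s) \<le> (\<Sum>s\<in>S - A. \<bar>?d s\<bar>)"
    unfolding sum_negf[symmetric] by (intro sum_mono) simp
  ultimately have "2 * (\<Sum>s\<in>S \<inter> A. ?d s) \<le> (\<Sum>s\<in>S. \<bar>?d s\<bar>)" by linarith
  then show ?thesis using pr assms by (simp add: tv_dist_def sum_subtractf)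
qed

text \<open>
  Doeblin's argument: a part of mass \<open>card S * \<delta>\<close> of the kernel is the same from every starting point
  and contributes nothing to the difference.
\<close>

lemma tv_contraction:
  fixes K :: "'s \<Rightarrow> 's pmf" and \<delta> :: real
  assumes S: "finite S" and supp: "set_pmf \<mu> \<subseteq> S" "set_pmf \<nu> \<subseteq> S"
    and stat: "bind_pmf \<nu> K = \<nu>"
    and \<delta>: "\<And>x y. x \<in> S \<Longrightarrow> y \<in> S \<Longrightarrow> \<delta> \<le> pmf (K x) y"
    and K: "\<And>x. x \<in> S \<Longrightarrow> set_pmf (K x) \<subseteq> S"
  shows "tv_dist S (bind_pmf \<mu> K) \<nu> \<le> (1 - card S * \<delta>) * tv_dist S \<mu> \<nu>"
proof -
  let ?d = "\<lambda>s. pmf \<mu> s - pmf \<nu> s"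
  have bind: "pmf (bind_pmf p K) y = (\<Sum>x\<in>S. pmf p x * pmf (K x) y)" if "set_pmf p \<subseteq> S" for p y
    unfolding pmf_bind using that S by (subst integral_measure_pmf[of S]) auto
  have d0: "(\<Sum>s\<in>S. ?d s) = 0"
    using assms by (simp add: sum_subtractf sum_pmf_eq_1)
  \<comment> \<open>The signed measure has total mass 0, so \<open>\<delta>\<close> can be subtracted from the kernel.\<close>
  have "pmf (bind_pmf \<mu> K) y - pmf \<nu> y = (\<Sum>x\<in>S. ?d x * (pmf (K x) y - \<delta>))" for y
  proof -
    have "pmf (bind_pmf \<mu> K) y - pmf (bind_pmf \<nu> K) y = (\<Sum>x\<in>S. ?d x * pmf (K x) y)"
      using bind supp by (simp add: sum_subtractf algebra_simps)
    also have "\<dots> = (\<Sum>x\<in>S. ?d x * (pmf (K x) y - \<delta>)) + \<delta> * (\<Sum>s\<in>S. ?d s)"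
      by (simp add: algebra_simps sum_subtractf sum.distrib sum_distrib_left)
    finally show ?thesis using d0 stat by simp
  qed
  then have "(\<Sum>y\<in>S. \<bar>pmf (bind_pmf \<mu> K) y - pmf \<nu> y\<bar>)
      = (\<Sum>y\<in>S. \<bar>\<Sum>x\<in>S. ?d x * (pmf (K x) y - \<delta>)\<bar>)" by simp
  also have "\<dots> \<le> (\<Sum>y\<in>S. \<Sum>x\<in>S. \<bar>?d x\<bar> * (pmf (K x) y - \<delta>))"
  proof (intro sum_mono order.trans[OF sum_abs] sum_mono)
    fix x y assume "y \<in> S" "x \<in> S"
    then show "\<bar>?d x * (pmf (K x) y - \<delta>)\<bar> \<le> \<bar>?d x\<bar> * (pmf (K x) y - \<delta>)"
      using \<delta>[of x y] by (simp add: abs_mult)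
  qed
  also have "\<dots> = (\<Sum>x\<in>S. \<bar>?d x\<bar> * (\<Sum>y\<in>S. pmf (K x) y - \<delta>))"
    by (subst sum.swap) (simp add: sum_distrib_left)
  also have "\<dots> = (\<Sum>x\<in>S. \<bar>?d x\<bar> * (1 - card S * \<delta>))"
    using S K by (intro sum.cong refl) (simp add: sum_subtractf sum_pmf_eq_1)
  also have "\<dots> = (1 - card S * \<delta>) * (\<Sum>x\<in>S. \<bar>?d x\<bar>)"
    by (simp add: sum_distrib_left mult.commute)
  finally show ?thesis by (simp add: tv_dist_def)
qed

lemma law_uniform_positive:
  assumes k: "2 \<le> k" "k \<le> n"
  shows "\<exists>T. \<exists>\<delta>>0. \<forall>x\<in>decks n. \<forall>y\<in>decks n. \<delta> \<le> pmf (shuffle_law n k x T) y"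
proof -
  have "\<forall>s\<in>decks n. \<exists>T. \<forall>t\<ge>T. set_pmf (shuffle_law n k s t) = decks n"
    using law_full_support[OF k] by metis
  then obtain T where T: "\<And>s t. s \<in> decks n \<Longrightarrow> t \<ge> T s \<Longrightarrow> set_pmf (shuffle_law n k s t) = decks n"
    by metis
  define T' where "T' = Max (T ` decks n)"
  define P where "P = (\<lambda>(x, y). pmf (shuffle_law n k x T') y) ` (decks n \<times> decks n)"
  have fin: "finite P" "P \<noteq> {}" by (auto simp: P_def)
  have "set_pmf (shuffle_law n k s T') = decks n" if "s \<in> decks n" for s
    using T[OF that, of T'] that by (auto simp: T'_def)
  then have "0 < p" if "p \<in> P" for p
    using that by (auto simp: P_def pmf_positive_iff)
  then have "0 < Min P" using fin by simp
  moreover have "Min P \<le> pmf (shuffle_law n k x T') y" if "x \<in> decks n" "y \<in> decks n" for x y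
    using fin that by (intro Min_le) (auto simp: P_def)
  ultimately show ?thesis by blast
qed

lemma shuffle_converges:
  assumes k: "2 \<le> k" "k \<le> n" and s: "s \<in> decks n" and e: "0 < e"
  shows "\<exists>t. tv_dist (decks n) (shuffle_law n k s t) (pmf_of_set (decks n)) \<le> e"
proof -
  let ?u = "pmf_of_set (decks n)"
  let ?tv = "\<lambda>t. tv_dist (decks n) (shuffle_law n k s t) ?u"
  have k': "1 \<le> k" using k by simp
  from law_uniform_positive[OF k] obtain T \<delta> where "0 < (\<delta>::real)"
    and \<delta>': "\<forall>x\<in>decks n. \<forall>y\<in>decks n. \<delta> \<le> pmf (shuffle_law n k x T) y"
    by auto
  then have \<delta>: "0 < \<delta>" "\<And>x y. x \<in> decks n \<Longrightarrow> y \<in> decks n \<Longrightarrow> \<delta> \<le> pmf (shuffle_law n k x T) y"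
    by auto
  define c where "c = 1 - card (decks n) * \<delta>"
  have "c < 1" using \<delta>(1) by (simp add: c_def card_gt_0_iff)
  have "(\<Sum>y\<in>decks n. \<delta>) \<le> (\<Sum>y\<in>decks n. pmf (shuffle_law n k s T) y)"
    using \<delta>(2) s by (intro sum_mono) auto
  also have "\<dots> = 1" by (rule sum_pmf_eq_1[OF finite_decks set_pmf_law_subset[OF k' k(2) s]])
  finally have "0 \<le> c" by (simp add: c_def)
  have step: "?tv (t + T) \<le> c * ?tv t" for t
    unfolding shuffle_law_add c_def
  proof (rule tv_contraction[OF finite_decks set_pmf_law_subset[OF k' k(2) s] _ uniform_stationary[OF k' k(2)]])
    show "set_pmf (pmf_of_set (decks n)) \<subseteq> decks n" by simp
    show "\<delta> \<le> pmf (shuffle_law n k x T) y" if "x \<in> decks n" "y \<in> decks n" for x y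
      using \<delta>(2) that .
    show "set_pmf (shuffle_law n k x T) \<subseteq> decks n" if "x \<in> decks n" for x
      using set_pmf_law_subset[OF k' k(2) that] .
  qed
  have iter: "?tv (j * T) \<le> c ^ j * ?tv 0" for j
  proof (induction j)
    case (Suc j)
    have "?tv (Suc j * T) \<le> c * ?tv (j * T)" using step[of "j * T"] by (simp add: add.commute)
    also have "\<dots> \<le> c * (c ^ j * ?tv 0)" using Suc \<open>0 \<le> c\<close> by (rule mult_left_mono)
    finally show ?case by simp
  qed simp
  have "(\<lambda>j. c ^ j * ?tv 0) \<longlonglongrightarrow> 0 * ?tv 0"
    using \<open>0 \<le> c\<close> \<open>c < 1\<close> by (intro tendsto_mult LIMSEQ_power_zero tendsto_const) simp
  then have "\<forall>\<^sub>F j in sequentially. c ^ j * ?tv 0 < e"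
    using e by (intro order_tendstoD) simp_all
  then obtain j where "c ^ j * ?tv 0 < e" by (auto simp: eventually_sequentially)
  then show ?thesis using iter[of j] by (intro exI[of _ "j * T"]) simp
qed

text \<open>
  A single starting deck suffices for a lower bound. Convergence enters because \<open>LEAST\<close> satisfies its
  defining property only if some time does.
\<close>

lemma mixing_time_ge:
  assumes k: "2 \<le> k" "k \<le> n" and s: "s \<in> decks n"
    and b: "\<And>t. tv_dist (decks n) (shuffle_law n k s t) (pmf_of_set (decks n)) \<le> 1 / 4 \<Longrightarrow> b \<le> real t"
  shows "b \<le> real (mixing_time n k)"
proof -
  let ?P = "\<lambda>s t. tv_dist (decks n) (shuffle_law n k s t) (pmf_of_set (decks n)) \<le> 1 / 4"
  have "?P s (LEAST t. ?P s t)"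
    using shuffle_converges[OF k s, of "1/4"] by (auto intro: LeastI_ex)
  then have "b \<le> real (LEAST t. ?P s t)" by (rule b)
  also have "(LEAST t. ?P s t) \<le> mixing_time n k"
    unfolding mixing_time_def using s by (intro Max_ge) auto
  finally show ?thesis by simp
qed

section \<open>Expectations along the chain\<close>

text \<open>
  One step of a drift estimate. It serves for the growth of the expectation in the coupon
  collector argument, for the variance recursion of Wilson's method, and, applied to a stationary
  distribution, for the equilibrium variance.
\<close>

lemma expectation_bind_le:
  fixes f :: "'a \<Rightarrow> real" and g :: "'b \<Rightarrow> real"
  assumes "finite S" "set_pmf \<mu> \<subseteq> S" "\<And>x. x \<in> S \<Longrightarrow> finite (set_pmf (K x))"
    and le: "\<And>x. x \<in> S \<Longrightarrow> measure_pmf.expectation (K x) g \<le> c * f x + r"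
  shows "measure_pmf.expectation (bind_pmf \<mu> K) g \<le> c * measure_pmf.expectation \<mu> f + r"
proof -
  have "measure_pmf.expectation (bind_pmf \<mu> K) g = (\<Sum>x\<in>S. pmf \<mu> x * measure_pmf.expectation (K x) g)"
    using assms by (subst pmf_expectation_bind[of S]) auto
  also have "\<dots> \<le> (\<Sum>x\<in>S. pmf \<mu> x * (c * f x + r))"
    by (intro sum_mono mult_left_mono le) auto
  also have "\<dots> = c * (\<Sum>x\<in>S. pmf \<mu> x * f x) + (\<Sum>x\<in>S. pmf \<mu> x) * r"
    by (simp add: algebra_simps sum.distrib sum_distrib_left sum_distrib_right)
  also have "\<dots> = c * measure_pmf.expectation \<mu> f + r"
    using assms by (subst integral_measure_pmf[of S]) (auto simp: sum_pmf_eq_1)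
  finally show ?thesis .
qed

lemma expectation_shuffle_step:
  fixes g :: "nat list \<Rightarrow> real"
  assumes "1 \<le> k" "k \<le> n"
  shows "measure_pmf.expectation (shuffle_step n k xs) g
    = (\<Sum>i\<in>{n - k + 1..n}. g (move_to_top i xs)) / k"
  using assms by (simp add: shuffle_step_def integral_pmf_of_set)

lemma prob_markov:
  fixes g :: "'a \<Rightarrow> real"
  assumes "finite (set_pmf M)" "\<And>x. 0 \<le> g x" "0 < c"
  shows "measure_pmf.prob M {x. c \<le> g x} \<le> measure_pmf.expectation M g / c"
  using integral_Markov_inequality_measure[of "measure_pmf M" g "{}" c] assms
  by (simp add: integrable_measure_pmf_finite)

section \<open>The coupon collector bound\<close>

text \<open>
  Started from the sorted deck, all cards not yet moved lie in the longest sorted suffix. Its length is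
  a function of the current deck alone and still drops by at most one per step, so it can replace the number of
  unmoved cards, which depends on the history.
\<close>

definition sorted_suffix :: "nat list \<Rightarrow> nat" where
  "sorted_suffix xs = Max {u. u \<le> length xs \<and> sorted (drop (length xs - u) xs)}"

lemma sorted_suffix_ge:
  "u \<le> length xs \<Longrightarrow> sorted (drop (length xs - u) xs) \<Longrightarrow> u \<le> sorted_suffix xs"
  unfolding sorted_suffix_def by (intro Max_ge) auto

lemma sorted_suffix_sorted:
  "sorted_suffix xs \<le> length xs" "sorted (drop (length xs - sorted_suffix xs) xs)"
proof -
  let ?U = "{u. u \<le> length xs \<and> sorted (drop (length xs - u) xs)}"
  have "finite ?U" "0 \<in> ?U" by auto
  then have "Max ?U \<in> ?U" by (intro Max_in) auto
  then show "sorted_suffix xs \<le> length xs" "sorted (drop (length xs - sorted_suffix xs) xs)"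
    by (simp_all add: sorted_suffix_def)
qed

lemma sorted_suffix_pos:
  assumes "xs \<noteq> []" shows "1 \<le> sorted_suffix xs"
proof (rule sorted_suffix_ge)
  show "sorted (drop (length xs - 1) xs)"
    by (rule sorted01) simp
qed (use assms in \<open>simp add: Suc_le_eq\<close>)

lemma sorted_suffix_move_to_top:
  assumes i: "1 \<le> i" "i \<le> length xs"
  shows "sorted_suffix xs \<le> sorted_suffix (move_to_top i xs) + (if i \<le> length xs - sorted_suffix xs then 0 else 1)"
proof -
  let ?L = "sorted_suffix xs"
  obtain as a bs where xs: "xs = as @ a # bs" and ia: "i = Suc (length as)"
    using split_at[OF i] by blast
  have ys: "move_to_top i xs = a # as @ bs" by (simp add: xs ia move_to_top_Cons)
  have L: "?L \<le> length xs" "sorted (drop (length xs - ?L) xs)" by (rule sorted_suffix_sorted)+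
  show ?thesis
  proof (cases "i \<le> length xs - ?L")
    case True
    then obtain e where "length xs - ?L = Suc (length as) + e"
      using ia le_Suc_ex by blast
    then have "drop (length xs - ?L) (a # as @ bs) = drop (length xs - ?L) xs"
      by (simp add: xs)
    then have "?L \<le> sorted_suffix (a # as @ bs)"
      using L by (intro sorted_suffix_ge) (simp_all add: xs)
    then show ?thesis using ys by simp
  next
    case False
    define d where "d = length xs - ?L"
    have d: "d \<le> length as" using False ia by (simp add: d_def)
    have "sorted (drop d as @ bs)"
      using L(2) d unfolding d_def[symmetric] by (simp add: xs sorted_append)
    moreover have "length (a # as @ bs) - (?L - 1) = Suc d"
      using False i L(1) by (simp add: xs d_def)
    ultimately have "?L - 1 \<le> sorted_suffix (a # as @ bs)"
      using L(1) d by (intro sorted_suffix_ge) (simp_all add: xs)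
    then show ?thesis using ys False by simp
  qed
qed

text \<open>
  If the suffix has length \<open>L\<close>, it gets shorter with probability at most \<open>L / k\<close>, and
  \<open>1 / L - 1 / (L + 1) = 1 / (L (L + 1))\<close>. For this reason \<open>1 / (L + 1)\<close> grows in mean by a factor
  \<open>1 + 1 / k\<close> at most, whatever \<open>L\<close> is, and no sum of waiting times has to be analysed.
\<close>

lemma sorted_suffix_step:
  assumes k: "1 \<le> k" "k \<le> n" and xs: "xs \<in> decks n"
  shows "measure_pmf.expectation (shuffle_step n k xs) (\<lambda>ys. 1 / (real (sorted_suffix ys) + 1))
    \<le> (1 + 1 / k) * (1 / (real (sorted_suffix xs) + 1))"
proof -
  let ?L = "sorted_suffix xs" and ?I = "{n - k + 1..n}"
  have len: "length xs = n" using length_decks[OF xs] .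
  have L: "1 \<le> ?L" "?L \<le> n"
    using sorted_suffix_pos[of xs] sorted_suffix_sorted(1)[of xs] len k by fastforce+
  have "(\<Sum>i\<in>?I. 1 / (real (sorted_suffix (move_to_top i xs)) + 1))
      \<le> (\<Sum>i\<in>?I. 1 / (real ?L + 1) + (if i \<in> {n - ?L<..n} then 1 / (real ?L * (real ?L + 1)) else 0))"
  proof (intro sum_mono)
    fix i assume i: "i \<in> ?I"
    have *: "?L \<le> sorted_suffix (move_to_top i xs) + (if i \<le> length xs - ?L then 0 else 1)"
      using sorted_suffix_move_to_top[of i xs] i len by simp
    show "1 / (real (sorted_suffix (move_to_top i xs)) + 1)
        \<le> 1 / (real ?L + 1) + (if i \<in> {n - ?L<..n} then 1 / (real ?L * (real ?L + 1)) else 0)"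
    proof (cases "i \<le> n - ?L")
      case True
      then show ?thesis using * len by (simp add: frac_le)
    next
      case False
      then have "real ?L \<le> real (sorted_suffix (move_to_top i xs)) + 1" using * len by simp
      then have "1 / (real (sorted_suffix (move_to_top i xs)) + 1) \<le> 1 / real ?L"
        using L by (intro frac_le) auto
      also have "\<dots> = 1 / (real ?L + 1) + 1 / (real ?L * (real ?L + 1))"
        using L by (simp add: field_simps add_nonneg_eq_0_iff)
      finally show ?thesis using False i by simp
    qed
  qed
  also have "\<dots> = k * (1 / (real ?L + 1)) + card (?I \<inter> {n - ?L<..n}) * (1 / (real ?L * (real ?L + 1)))"
    by (simp only: sum.distrib sum.inter_restrict[OF finite_atLeastAtMost, symmetric] sum_constant card_atLeastAtMost)
       (use k in simp)
  also have "\<dots> \<le> k * (1 / (real ?L + 1)) + ?L * (1 / (real ?L * (real ?L + 1)))"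
  proof -
    have "card (?I \<inter> {n - ?L<..n}) \<le> card {n - ?L<..n}" by (intro card_mono) auto
    also have "\<dots> = ?L" using L by simp
    finally show ?thesis by (intro add_left_mono mult_right_mono) auto
  qed
  also have "?L * (1 / (real ?L * (real ?L + 1))) = 1 / (real ?L + 1)"
    using L by simp
  also have "k * (1 / (real ?L + 1)) + 1 / (real ?L + 1) = k * ((1 + 1 / k) * (1 / (real ?L + 1)))"
  proof -
    have "real k * a + a = real k * ((1 + 1 / real k) * a)" for a
      using k by (simp add: field_simps)
    then show ?thesis .
  qed
  finally show ?thesis
    using k by (simp add: expectation_shuffle_step pos_divide_le_eq mult.commute)
qed

lemma sorted_suffix_expectation:
  assumes k: "1 \<le> k" "k \<le> n"
  shows "measure_pmf.expectation (shuffle_law n k [1..<Suc n] t) (\<lambda>ys. 1 / (real (sorted_suffix ys) + 1))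
    \<le> (1 + 1 / k) ^ t / (real n + 1)"
proof (induction t)
  case 0
  have "sorted (drop d [1..<Suc n])" for d
    by (simp add: drop_upt del: upt_Suc)
  then have "n \<le> sorted_suffix [1..<Suc n]" by (intro sorted_suffix_ge) (simp_all del: upt_Suc)
  then show ?case by (simp add: frac_le del: upt_Suc)
next
  case (Suc t)
  have s: "[1..<Suc n] \<in> decks n" by (auto simp: decks_iff)
  have "measure_pmf.expectation (shuffle_law n k [1..<Suc n] (Suc t)) (\<lambda>ys. 1 / (real (sorted_suffix ys) + 1))
    \<le> (1 + 1 / k) * measure_pmf.expectation (shuffle_law n k [1..<Suc n] t)
        (\<lambda>ys. 1 / (real (sorted_suffix ys) + 1)) + 0"
    unfolding shuffle_law.simps
    by (rule expectation_bind_le[OF finite_decks set_pmf_law_subset[OF k s]])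
       (use sorted_suffix_step[OF k] set_pmf_shuffle_step[OF k] in auto)
  also have "\<dots> \<le> (1 + 1 / k) * ((1 + 1 / k) ^ t / (real n + 1)) + 0"
    using Suc.IH by (intro add_mono mult_left_mono) auto
  finally show ?case by simp
qed

text \<open>
  Exchanging the last two cards preserves the uniform distribution and maps the event into its complement.
\<close>

lemma uniform_last_two_sorted:
  assumes n: "2 \<le> n"
  shows "measure_pmf.prob (pmf_of_set (decks n)) {xs. xs ! (n - 2) \<le> xs ! (n - 1)} \<le> 1 / 2"
proof -
  let ?u = "pmf_of_set (decks n)" and ?A = "{xs. xs ! (n - 2) \<le> xs ! (n - 1)}"
  define \<tau> where "\<tau> xs = xs[n - 2 := xs ! (n - 1), n - 1 := xs ! (n - 2)]" for xs :: "nat list"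
  have D: "\<tau> xs \<in> decks n" if "xs \<in> decks n" for xs
    using mset_decks[OF that, of "\<tau> xs"] mset_swap[of "n - 1" xs "n - 2"] length_decks[OF that] n
    by (simp add: \<tau>_def)
  have inv: "\<tau> (\<tau> xs) = xs" if "xs \<in> decks n" for xs
    using length_decks[OF that] n
    by (intro nth_equalityI) (auto simp: \<tau>_def nth_list_update)
  have "bij_betw \<tau> (decks n) (decks n)"
    by (rule bij_betw_byWitness[of _ \<tau>]) (use D inv in auto)
  then have u: "map_pmf \<tau> ?u = ?u"
    by (rule map_pmf_of_set_bij_betw) auto
  have "measure_pmf.prob ?u ?A = measure_pmf.prob (map_pmf \<tau> ?u) ?A" by (simp add: u)
  also have "\<dots> = measure_pmf.prob ?u (\<tau> -` ?A)" by simp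
  also have "\<dots> \<le> measure_pmf.prob ?u (- ?A)"
  proof (rule measure_pmf.finite_measure_mono_AE)
    have "\<tau> xs ! (n - 2) = xs ! (n - 1)" "\<tau> xs ! (n - 1) = xs ! (n - 2)"
      "xs ! (n - 2) \<noteq> xs ! (n - 1)" if "xs \<in> decks n" for xs
      using length_decks[OF that] that n by (auto simp: \<tau>_def nth_list_update decks_iff nth_eq_iff_index_eq)
    then show "AE x in ?u. x \<in> \<tau> -` ?A \<longrightarrow> x \<in> - ?A"
      by (auto simp: AE_measure_pmf_iff)
  qed simp
  also have "\<dots> = 1 - measure_pmf.prob ?u ?A"
    using measure_pmf.prob_compl[of ?A ?u] by (simp add: Compl_eq_Diff_UNIV)
  finally show ?thesis by simp
qed

text \<open>
  If the last two cards are out of order, the sorted suffix has length at most one and the statistic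
  \<open>1 / (L + 1)\<close> is at least \<open>1 / 2\<close>, which Markov's inequality makes unlikely.
\<close>

lemma mixing_time_ge_k_log:
  assumes k: "2 \<le> k" "k \<le> n"
  shows "real k * ln ((real n + 1) / 8) \<le> mixing_time n k"
proof (rule mixing_time_ge[OF k])
  let ?s = "[1..<Suc n]" and ?u = "pmf_of_set (decks n)"
  have k': "1 \<le> k" and n: "2 \<le> n" using k by auto
  show s: "?s \<in> decks n" by (auto simp: decks_iff)
  fix t assume tv: "tv_dist (decks n) (shuffle_law n k ?s t) ?u \<le> 1 / 4"
  let ?\<mu> = "shuffle_law n k ?s t" and ?A = "{xs. xs ! (n - 2) \<le> xs ! (n - 1)}"
  let ?h = "\<lambda>ys. 1 / (real (sorted_suffix ys) + 1)"
  note sub = set_pmf_law_subset[OF k' k(2) s, of t]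
  have "measure_pmf.prob ?\<mu> (- ?A) \<le> measure_pmf.prob ?\<mu> {xs. 1 / 2 \<le> ?h xs}"
  proof (rule measure_pmf.finite_measure_mono_AE)
    have "1 / 2 \<le> ?h xs" if xs: "xs \<in> decks n" "xs \<notin> ?A" for xs
    proof -
      have len: "length xs = n" using length_decks xs(1) .
      have "sorted_suffix xs < 2"
      proof (rule ccontr)
        assume "\<not> sorted_suffix xs < 2"
        then have ge: "2 \<le> sorted_suffix xs" by simp
        let ?L = "sorted_suffix xs"
        have L: "?L \<le> n" "sorted (drop (n - ?L) xs)" using sorted_suffix_sorted[of xs] len by auto
        have "drop (n - ?L) xs ! (?L - 2) \<le> drop (n - ?L) xs ! (?L - 1)"
          using L ge len by (intro sorted_nth_mono) auto
        then have "xs ! (n - 2) \<le> xs ! (n - 1)" using L ge len by simp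
        then show False using xs(2) by simp
      qed
      then show ?thesis by (simp add: field_simps)
    qed
    then show "AE x in ?\<mu>. x \<in> - ?A \<longrightarrow> x \<in> {xs. 1 / 2 \<le> ?h xs}"
      using sub by (auto simp: AE_measure_pmf_iff)
  qed simp
  also have "\<dots> \<le> measure_pmf.expectation ?\<mu> ?h / (1 / 2)"
    using finite_set_pmf_law[OF k' k(2) s] by (intro prob_markov) auto
  also have "\<dots> \<le> 2 * ((1 + 1 / k) ^ t / (real n + 1))"
    using sorted_suffix_expectation[OF k' k(2), of t] by simp
  finally have 1: "measure_pmf.prob ?\<mu> (- ?A) \<le> 2 * ((1 + 1 / k) ^ t / (real n + 1))" .
  have "measure_pmf.prob ?\<mu> (- ?A) = 1 - measure_pmf.prob ?\<mu> ?A"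
    using measure_pmf.prob_compl[of ?A ?\<mu>] by (simp add: Compl_eq_Diff_UNIV)
  moreover have "measure_pmf.prob ?\<mu> ?A - measure_pmf.prob ?u ?A \<le> 1 / 4"
    using tv_prob_le[OF finite_decks sub, of ?u ?A] tv by simp
  ultimately have "1 / 4 \<le> 2 * ((1 + 1 / k) ^ t / (real n + 1))"
    using 1 uniform_last_two_sorted[OF n] by linarith
  then have "(real n + 1) / 8 \<le> (1 + 1 / k) ^ t" by (simp add: field_simps)
  also have "\<dots> \<le> exp (1 / k) ^ t"
    using k by (intro power_mono exp_ge_add_one_self) auto
  also have "\<dots> = exp (t / k)" by (simp flip: exp_of_nat_mult)
  finally have "ln ((real n + 1) / 8) \<le> t / k" using ln_mono[of "(real n + 1) / 8" "exp (t / k)"] by simp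
  then show "real k * ln ((real n + 1) / 8) \<le> real t" using k by (simp add: field_simps)
qed

section \<open>The eigenvalue of the single card motion\<close>

lemma pi_bounds: "3 < pi" "pi < 63 / 20"
  using pi_approx by auto

lemma Ln_approx_quadratic:
  fixes z :: complex
  assumes z: "norm z \<le> 1 / 2"
  shows "norm (Ln (1 + z) - z + z\<^sup>2 / 2) \<le> 8 * norm z ^ 3"
proof -
  define f :: "nat \<Rightarrow> complex \<Rightarrow> complex" where "f i x =
    (if i = 0 then Ln (1 + x) else if i = 1 then 1 / (1 + x) else if i = 2 then - 1 / (1 + x) ^ 2
     else 2 / (1 + x) ^ 3)" for i x
  have ball: "norm x \<le> 1 / 2" if "x \<in> closed_segment 0 z" for x
    using segment_bound1[OF that] z by simp
  have re: "1 + x \<notin> \<real>\<^sub>\<le>\<^sub>0" "1 / 2 \<le> norm (1 + x)" "1 + x \<noteq> 0" if "x \<in> closed_segment 0 z" for x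
  proof -
    have "norm (1::complex) - norm x \<le> norm (1 + x)"
      by (metis add.commute norm_diff_ineq)
    then show 1: "1 / 2 \<le> norm (1 + x)" using ball[OF that] by simp
    show "1 + x \<noteq> 0" using 1 by auto
    have "\<bar>Re x\<bar> \<le> 1 / 2" using abs_Re_le_cmod[of x] ball[OF that] by linarith
    then show "1 + x \<notin> \<real>\<^sub>\<le>\<^sub>0" by (auto simp: complex_nonpos_Reals_iff)
  qed
  have "norm (f 0 z - (\<Sum>i\<le>2. f i 0 * (z - 0) ^ i / fact i)) \<le> 16 * norm (z - 0) ^ Suc 2 / fact 2"
  proof (rule complex_Taylor)
    show "convex (closed_segment 0 z)" by simp
    fix i x assume x: "x \<in> closed_segment 0 z" and "i \<le> (2::nat)"
    then consider "i = 0" | "i = 1" | "i = 2" by linarith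
    then show "(f i has_field_derivative f (Suc i) x) (at x within closed_segment 0 z)"
    proof cases
      case 1
      then show ?thesis unfolding f_def using re[OF x]
        by (auto intro!: derivative_eq_intros simp: field_simps)
    next
      case 2
      then show ?thesis unfolding f_def using re[OF x]
        by (auto intro!: derivative_eq_intros simp: power2_eq_square)
    next
      case 3
      have "- ((- 2 - 2 * x) / (1 + x) ^ 4) = 2 / (1 + x) ^ 3"
      proof -
        have "- 2 - 2 * x = - (2 * (1 + x))" by simp
        moreover have "2 * w / w ^ 4 = 2 / w ^ 3" if "w \<noteq> 0" for w :: complex
          using that by (simp add: field_simps eval_nat_numeral)
        ultimately show ?thesis using re(3)[OF x] by (simp only: divide_minus_left minus_minus not_False_eq_True)
      qed
      moreover have "((\<lambda>x. - 1 / (1 + x)\<^sup>2) has_field_derivative - ((- 2 - 2 * x) / (1 + x) ^ 4))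
          (at x within closed_segment 0 z)"
        using re[OF x] by (auto intro!: derivative_eq_intros)
      moreover have "f 2 = (\<lambda>x. - 1 / (1 + x)\<^sup>2)" "f (Suc 2) x = 2 / (1 + x) ^ 3"
        by (auto simp: f_def fun_eq_iff)
      ultimately show ?thesis using 3 by (simp only:)
    qed
  next
    fix x assume x: "x \<in> closed_segment 0 z"
    have "(1 / 2) ^ 3 \<le> norm (1 + x) ^ 3" using re[OF x] by (intro power_mono) auto
    then have "2 / norm (1 + x) ^ 3 \<le> 2 / (1 / 2) ^ 3" by (intro divide_left_mono) (use re[OF x] in auto)
    also have "2 / (1 / 2) ^ 3 = (16 :: real)" by (simp add: power3_eq_cube)
    finally show "norm (f (Suc 2) x) \<le> 16" by (simp add: f_def norm_divide norm_power)
  qed auto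
  moreover have "f 0 z - (\<Sum>i\<le>2. f i 0 * (z - 0) ^ i / fact i) = Ln (1 + z) - z + z\<^sup>2 / 2"
    by (simp add: f_def numeral_2_eq_2)
  ultimately show ?thesis by (simp add: numeral_3_eq_3)
qed

text \<open>
  The quantity \<open>Ln (1 + y)\<close> is minus the logarithm of the Laplace transform \<open>E exp (- \<theta> G)\<close> of the geometric
  variable \<open>G\<close> with parameter \<open>1 / k\<close>. So the expansion has the mean \<open>k\<close> and half the variance \<open>k (k - 1)\<close> as
  its first two coefficients, up to sign. The point of the estimate is that the error is uniform in \<open>k\<close> when measured in
  \<open>k \<bar>\<theta>\<bar>\<close>.
\<close>

lemma log_geometric_approx:
  fixes \<theta> :: complex and k :: nat
  assumes k: "2 \<le> k" and small: "real k * norm \<theta> \<le> 1 / 4"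
  defines "y \<equiv> of_nat k * (exp \<theta> - 1)"
  shows "norm y \<le> 1 / 2"
    and "norm (Ln (1 + y) - of_nat k * \<theta> + of_nat k * (of_nat k - 1) * \<theta>\<^sup>2 / 2)
      \<le> 67 * (real k * norm \<theta>) ^ 3"
proof -
  define \<tau> A where "\<tau> = norm \<theta>" and "A = real k * norm \<theta>"
  have \<tau>: "0 \<le> \<tau>" "2 * \<tau> \<le> A" "\<tau> \<le> 1 / 8" "A = real k * \<tau>"
    using k small mult_right_mono[of 2 "real k" \<tau>] by (auto simp: \<tau>_def A_def)
  have A: "0 \<le> A" "A \<le> 1 / 4" using small by (auto simp: A_def)
  define \<rho> where "\<rho> = exp \<theta> - 1 - \<theta> - \<theta>\<^sup>2 / 2"
  have "norm (exp \<theta> - (\<Sum>i\<le>2. \<theta> ^ i / fact i)) \<le> exp (norm \<theta>) * norm \<theta> ^ Suc 2 / fact 2"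
    by (rule Taylor_exp_field)
  moreover have "exp \<theta> - (\<Sum>i\<le>2. \<theta> ^ i / fact i) = \<rho>"
    by (simp add: \<rho>_def numeral_2_eq_2)
  moreover have "exp (norm \<theta>) \<le> 2"
    using exp_bound_half[of "norm \<theta>"] \<tau> by (simp add: \<tau>_def)
  ultimately have "norm \<rho> \<le> exp \<tau> * (\<tau> ^ 3 / 2)" "exp \<tau> \<le> 2"
    by (simp_all add: \<tau>_def numeral_3_eq_3)
  moreover have "exp \<tau> * (\<tau> ^ 3 / 2) \<le> 2 * (\<tau> ^ 3 / 2)"
    using \<tau> \<open>exp \<tau> \<le> 2\<close> by (intro mult_right_mono) auto
  ultimately have \<rho>: "norm \<rho> \<le> \<tau> ^ 3" by linarith
  have y: "y = of_nat k * \<theta> + of_nat k * \<theta>\<^sup>2 / 2 + of_nat k * \<rho>"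
    by (simp add: y_def \<rho>_def algebra_simps)
  have \<tau>3: "\<tau> ^ 3 \<le> \<tau>\<^sup>2 / 8"
    using mult_left_mono[OF \<tau>(3), of "\<tau>\<^sup>2"] by (simp add: power3_eq_cube power2_eq_square)
  have yk: "norm (y - of_nat k * \<theta>) \<le> k * \<tau>\<^sup>2"
  proof -
    have "y - of_nat k * \<theta> = of_nat k * (\<theta>\<^sup>2 / 2 + \<rho>)" by (simp add: y algebra_simps)
    then have "norm (y - of_nat k * \<theta>) = k * norm (\<theta>\<^sup>2 / 2 + \<rho>)" by (simp add: norm_mult)
    also have "norm (\<theta>\<^sup>2 / 2 + \<rho>) \<le> \<tau>\<^sup>2 / 2 + \<tau> ^ 3"
      using \<rho> by (intro norm_triangle_le add_mono) (auto simp: \<tau>_def norm_divide norm_power)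
    also have "\<dots> \<le> \<tau>\<^sup>2" using \<tau>3 zero_le_power2[of \<tau>] by linarith
    finally show ?thesis by (simp add: mult_left_mono)
  qed
  have k\<tau>2: "k * \<tau>\<^sup>2 \<le> A / 8"
    using mult_left_mono[OF \<tau>(3), of A] A \<tau>(4) by (simp add: power2_eq_square mult.assoc)
  have nk: "norm (of_nat k * \<theta>) = A" by (simp add: A_def norm_mult)
  have ny: "norm y \<le> 2 * A"
    using norm_triangle_sub[of y "of_nat k * \<theta>"] yk k\<tau>2 nk A by linarith
  then show y2: "norm y \<le> 1 / 2" using A by linarith
  have 1: "norm (y\<^sup>2 - (of_nat k * \<theta>)\<^sup>2) \<le> 3 * A ^ 3"
  proof -
    have "norm (y\<^sup>2 - (of_nat k * \<theta>)\<^sup>2) = norm (y - of_nat k * \<theta>) * norm (y + of_nat k * \<theta>)"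
      by (simp flip: norm_mult add: power2_eq_square algebra_simps)
    also have "\<dots> \<le> (k * \<tau>\<^sup>2) * (3 * A)"
      using yk norm_triangle_ineq[of y "of_nat k * \<theta>"] ny nk by (intro mult_mono) auto
    also have "\<dots> \<le> (A * A) * (3 * A)"
      using \<tau> A mult_left_mono[of \<tau> A A] by (intro mult_right_mono) (auto simp: power2_eq_square)
    finally show ?thesis by (simp add: power3_eq_cube)
  qed
  have 2: "norm (of_nat k * \<rho>) \<le> A ^ 3"
  proof -
    have "norm (of_nat k * \<rho>) \<le> k * \<tau> ^ 3" using \<rho> by (simp add: norm_mult mult_left_mono)
    also have "\<dots> = A * \<tau>\<^sup>2" using \<tau> by (simp add: power3_eq_cube power2_eq_square)
    also have "\<dots> \<le> A * A\<^sup>2" using \<tau> A by (intro mult_left_mono power_mono) auto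
    finally show ?thesis by (simp add: power3_eq_cube power2_eq_square)
  qed
  have 3: "norm (Ln (1 + y) - y + y\<^sup>2 / 2) \<le> 64 * A ^ 3"
  proof -
    have "8 * norm y ^ 3 \<le> 8 * (2 * A) ^ 3" using ny by (intro mult_left_mono power_mono) auto
    then show ?thesis using Ln_approx_quadratic[OF y2] by (simp add: power_mult_distrib)
  qed
  have "Ln (1 + y) - of_nat k * \<theta> + of_nat k * (of_nat k - 1) * \<theta>\<^sup>2 / 2
      = (Ln (1 + y) - y + y\<^sup>2 / 2) + of_nat k * \<rho> - (y\<^sup>2 - (of_nat k * \<theta>)\<^sup>2) / 2"
  proof -
    have "l - K * \<theta> + K * (K - 1) * \<theta>\<^sup>2 / 2 = (l - Y + Y\<^sup>2 / 2) + K * \<rho> - (Y\<^sup>2 - (K * \<theta>)\<^sup>2) / 2"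
      if Y: "Y = K * \<theta> + K * \<theta>\<^sup>2 / 2 + K * \<rho>" for l K Y
    proof -
      have "(l - Y + Y\<^sup>2 / 2) + K * \<rho> - (Y\<^sup>2 - (K * \<theta>)\<^sup>2) / 2 = l - (Y - K * \<rho>) + (K * \<theta>)\<^sup>2 / 2"
        by (simp add: diff_divide_distrib)
      also have "Y - K * \<rho> = K * \<theta> + K * \<theta>\<^sup>2 / 2" using Y by simp
      finally show ?thesis by (simp add: power2_eq_square field_simps)
    qed
    from this[OF y] show ?thesis .
  qed
  also have "norm \<dots> \<le> norm (Ln (1 + y) - y + y\<^sup>2 / 2) + norm (of_nat k * \<rho>)
      + norm (y\<^sup>2 - (of_nat k * \<theta>)\<^sup>2) / 2"
  proof -
    have "norm (a + b - c / 2) \<le> norm a + norm b + norm c / 2" for a b c :: complex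
      using norm_triangle_ineq4[of "a + b" "c / 2"] norm_triangle_ineq[of a b] by (simp add: norm_divide)
    then show ?thesis .
  qed
  also have "\<dots> \<le> 67 * A ^ 3"
    using 1 2 3 zero_le_power[OF A(1), of 3] by linarith
  finally show "norm (Ln (1 + y) - of_nat k * \<theta> + of_nat k * (of_nat k - 1) * \<theta>\<^sup>2 / 2)
      \<le> 67 * (real k * norm \<theta>) ^ 3"
    by (simp only: A_def)
qed

text \<open>
  Here \<open>exp \<theta>\<close> is the eigenvalue. Taking logarithms, with the branch for which a card winds once around the
  deck, the equation reads \<open>n \<theta> = 2 \<pi> i + k (k - 1) \<theta>\<^sup>2 / 2 + O((k \<bar>\<theta>\<bar>)\<^sup>3)\<close>. The solution lies so close to
  \<open>2 \<pi> i / n\<close> that \<open>\<theta>\<^sup>2\<close> may be replaced by \<open>- 4 \<pi>\<^sup>2 / n\<^sup>2\<close>, which gives the real part. Existence comes from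
  Brouwer's theorem, for which it is enough that the correction terms are small. The factor
  \<open>10000\<close> is a generous choice that makes all error terms harmless.
\<close>

lemma eigenvalue_exists:
  fixes n k :: nat
  assumes k: "2 \<le> k" and kn: "10000 * k \<le> n"
  defines "S \<equiv> real k * (real k - 1) / (real n)\<^sup>2"
  obtains \<theta> :: complex where
    "exp (of_nat (n - k) * \<theta>) * (1 + of_nat k * (exp \<theta> - 1)) = 1"
    "norm \<theta> \<le> 7 / n"
    "\<bar>n * Re \<theta> + 2 * pi\<^sup>2 * S\<bar> \<le> 60000 * (k / n) * S"
proof -
  define x where "x = real k / real n"
  have n: "0 < real n" using k kn by simp
  have x: "0 \<le> x" "x \<le> 1 / 10000" using kn n by (auto simp: x_def field_simps)
  have S: "x\<^sup>2 / 2 \<le> S" "S \<le> x\<^sup>2" "0 \<le> S"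
    using k n by (auto simp: S_def x_def power_divide power2_eq_square field_simps)
  define \<theta>0 :: complex where "\<theta>0 = 2 * pi * \<i> / n"
  \<comment> \<open>The fixed point map moves \<open>\<theta>0\<close> by at most \<open>900 (k / n)\<^sup>2 / n\<close>; this is the radius of a ball that it preserves.\<close>
  define r where "r = 900 * x\<^sup>2 / n"
  define y where "y \<theta> = of_nat k * (exp \<theta> - 1)" for \<theta> :: complex
  define G where "G \<theta> = Ln (1 + y \<theta>) - of_nat k * \<theta> + of_nat k * (of_nat k - 1) * \<theta>\<^sup>2 / 2" for \<theta>
  define F where "F \<theta> = (2 * pi * \<i> - (Ln (1 + y \<theta>) - of_nat k * \<theta>)) / n" for \<theta>
  have r0: "0 < r" using n k by (simp add: r_def x_def)
  have x2: "x\<^sup>2 \<le> x / 10000"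
    using mult_left_mono[OF x(2), of x] x(1) by (simp add: power2_eq_square)
  have rn: "r * n \<le> 1 / 10" "r * n = 900 * x\<^sup>2" using x2 x n by (auto simp: r_def)
  have n0: "norm \<theta>0 = 2 * pi / n" by (simp add: \<theta>0_def norm_mult norm_divide)
  have norm7: "norm \<theta> \<le> 7 / n" if "\<theta> \<in> cball \<theta>0 r" for \<theta>
  proof -
    have "norm \<theta> \<le> norm \<theta>0 + r"
      using that norm_triangle_sub[of \<theta> \<theta>0] by (simp add: dist_norm norm_minus_commute)
    also have "\<dots> \<le> 7 / n" using pi_bounds rn n n0 by (simp add: field_simps)
    finally show ?thesis .
  qed
  have A: "k * norm \<theta> \<le> 7 * x" "k * norm \<theta> \<le> 1 / 4" if "\<theta> \<in> cball \<theta>0 r" for \<theta>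
    using mult_left_mono[OF norm7[OF that], of "real k"] x by (auto simp: x_def mult.commute)
  \<comment> \<open>The constant is \<open>67 * 7 ^ 3\<close>, as \<open>\<bar>\<theta>\<bar> \<le> 7 / n\<close> on the ball.\<close>
  have G: "norm (G \<theta>) \<le> 22981 * x ^ 3" if "\<theta> \<in> cball \<theta>0 r" for \<theta>
  proof -
    have "norm (G \<theta>) \<le> 67 * (k * norm \<theta>) ^ 3"
      unfolding G_def y_def by (rule log_geometric_approx(2)[OF k A(2)[OF that]])
    also have "\<dots> \<le> 67 * (7 * x) ^ 3" using A[OF that] by (intro mult_left_mono power_mono) auto
    finally show ?thesis by (simp add: power_mult_distrib)
  qed
  have ny: "norm (y \<theta>) \<le> 1 / 2" if "\<theta> \<in> cball \<theta>0 r" for \<theta>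
    unfolding y_def by (rule log_geometric_approx(1)[OF k A(2)[OF that]])
  have y1: "1 + y \<theta> \<notin> \<real>\<^sub>\<le>\<^sub>0" if "\<theta> \<in> cball \<theta>0 r" for \<theta>
    using abs_Re_le_cmod[of "y \<theta>"] ny[OF that] by (auto simp: complex_nonpos_Reals_iff)
  have kk: "norm (of_nat k * (of_nat k - 1) :: complex) = S * n\<^sup>2"
  proof -
    have "of_nat k * (of_nat k - 1) = (of_real (real k * (real k - 1)) :: complex)" by simp
    then show ?thesis using k n by (simp only: norm_of_real) (simp add: S_def)
  qed
  have "F \<in> cball \<theta>0 r \<rightarrow> cball \<theta>0 r"
  proof
    fix \<theta> assume \<theta>: "\<theta> \<in> cball \<theta>0 r"
    have "norm (of_nat k * (of_nat k - 1) * \<theta>\<^sup>2 / 2) = S * (n * norm \<theta>)\<^sup>2 / 2"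
      using kk by (simp add: norm_mult norm_divide norm_power power_mult_distrib)
    also have "\<dots> \<le> x\<^sup>2 * 7\<^sup>2 / 2"
      using S norm7[OF \<theta>] n by (intro divide_right_mono mult_mono power_mono) (auto simp: field_simps)
    also have "\<dots> \<le> 25 * x\<^sup>2" by simp
    finally have 1: "norm (of_nat k * (of_nat k - 1) * \<theta>\<^sup>2 / 2) \<le> 25 * x\<^sup>2" .
    have "x ^ 3 * 10000 \<le> x\<^sup>2"
      using mult_left_mono[OF x(2), of "x\<^sup>2"] by (simp add: power3_eq_cube power2_eq_square)
    then have "22981 * x ^ 3 \<le> 100 * x\<^sup>2"
      using zero_le_power2[of x] by linarith
    then have 2: "norm (G \<theta>) \<le> 100 * x\<^sup>2" using G[OF \<theta>] by linarith
    have "Ln (1 + y \<theta>) - of_nat k * \<theta> = G \<theta> - of_nat k * (of_nat k - 1) * \<theta>\<^sup>2 / 2"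
      by (simp add: G_def)
    then have "norm (Ln (1 + y \<theta>) - of_nat k * \<theta>) \<le> norm (G \<theta>) + norm (of_nat k * (of_nat k - 1) * \<theta>\<^sup>2 / 2)"
      by (simp only: norm_triangle_ineq4)
    also have "\<dots> \<le> 900 * x\<^sup>2"
      using 1 2 zero_le_power2[of x] by linarith
    finally have "norm (Ln (1 + y \<theta>) - of_nat k * \<theta>) \<le> 900 * x\<^sup>2" .
    moreover have "\<theta>0 - F \<theta> = (Ln (1 + y \<theta>) - of_nat k * \<theta>) / n"
      using n by (simp add: \<theta>0_def F_def field_simps)
    ultimately have "norm (\<theta>0 - F \<theta>) \<le> r"
      using n by (simp add: norm_divide r_def divide_right_mono)
    then show "F \<theta> \<in> cball \<theta>0 r" by (simp add: dist_norm)
  qed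
  moreover have "continuous_on (cball \<theta>0 r) F"
    unfolding F_def using y1 n
    by (intro continuous_intros) (auto simp: y_def intro!: continuous_intros)
  ultimately obtain \<theta> where \<theta>: "\<theta> \<in> cball \<theta>0 r" "F \<theta> = \<theta>"
    using brouwer_ball[OF r0] by metis
  have fix1: "n * \<theta> = 2 * pi * \<i> - (Ln (1 + y \<theta>) - of_nat k * \<theta>)"
    using \<theta>(2) n by (simp add: F_def field_simps)
  have sum: "of_nat (n - k) * \<theta> + Ln (1 + y \<theta>) = 2 * pi * \<i>"
    using fix1 kn by (simp add: of_nat_diff algebra_simps)
  have "exp (of_nat (n - k) * \<theta>) * exp (Ln (1 + y \<theta>)) = 1"
    unfolding exp_add[symmetric] sum by (simp add: exp_eq_polar cis_2pi flip: cis_conv_exp)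
  moreover have "1 + y \<theta> \<noteq> 0" using y1[OF \<theta>(1)] by auto
  ultimately have eq: "exp (of_nat (n - k) * \<theta>) * (1 + of_nat k * (exp \<theta> - 1)) = 1"
    by (simp add: y_def)
  define \<delta> where "\<delta> = \<theta> - \<theta>0"
  have \<delta>: "norm \<delta> \<le> r" using \<theta>(1) by (simp add: \<delta>_def dist_norm norm_minus_commute)
  have "norm (\<theta>\<^sup>2 - \<theta>0\<^sup>2) \<le> 14 * r / n"
  proof -
    have "norm (\<theta>\<^sup>2 - \<theta>0\<^sup>2) = norm \<delta> * norm (\<theta> + \<theta>0)"
      by (simp flip: norm_mult add: \<delta>_def power2_eq_square algebra_simps)
    also have "\<dots> \<le> r * (7 / n + 7 / n)"
      using \<delta> norm7[OF \<theta>(1)] norm7[of \<theta>0] r0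
      by (intro mult_mono norm_triangle_le add_mono) auto
    finally show ?thesis by (simp add: mult.commute)
  qed
  moreover have "\<theta>0\<^sup>2 = - of_real (4 * pi\<^sup>2 / n\<^sup>2)"
    by (simp add: \<theta>0_def power_divide power_mult_distrib)
  ultimately have "\<bar>Re (\<theta>\<^sup>2) + 4 * pi\<^sup>2 / n\<^sup>2\<bar> \<le> 14 * r / n"
    using abs_Re_le_cmod[of "\<theta>\<^sup>2 - \<theta>0\<^sup>2"] by simp
  then have "(S * n\<^sup>2 / 2) * \<bar>Re (\<theta>\<^sup>2) + 4 * pi\<^sup>2 / n\<^sup>2\<bar> \<le> (S * n\<^sup>2 / 2) * (14 * r / n)"
    using S by (intro mult_left_mono) auto
  moreover have "(S * n\<^sup>2 / 2) * (14 * r / n) = 6300 * x\<^sup>2 * S"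
    using n rn by (simp add: power2_eq_square field_simps)
  moreover have "(S * n\<^sup>2 / 2) * \<bar>Re (\<theta>\<^sup>2) + 4 * pi\<^sup>2 / n\<^sup>2\<bar> = \<bar>S * n\<^sup>2 / 2 * Re (\<theta>\<^sup>2) + 2 * pi\<^sup>2 * S\<bar>"
  proof -
    have "(S * n\<^sup>2 / 2) * \<bar>Re (\<theta>\<^sup>2) + 4 * pi\<^sup>2 / n\<^sup>2\<bar> = \<bar>(S * n\<^sup>2 / 2) * (Re (\<theta>\<^sup>2) + 4 * pi\<^sup>2 / n\<^sup>2)\<bar>"
      using S by (simp only: abs_mult) simp
    also have "(S * n\<^sup>2 / 2) * (Re (\<theta>\<^sup>2) + 4 * pi\<^sup>2 / n\<^sup>2) = S * n\<^sup>2 / 2 * Re (\<theta>\<^sup>2) + 2 * pi\<^sup>2 * S"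
      using n by (simp add: field_simps)
    finally show ?thesis .
  qed
  ultimately have 1: "\<bar>S * n\<^sup>2 / 2 * Re (\<theta>\<^sup>2) + 2 * pi\<^sup>2 * S\<bar> \<le> 6300 * x\<^sup>2 * S" by linarith
  have "6300 * x\<^sup>2 * S \<le> x * S" using x2 x S by (intro mult_right_mono) auto
  moreover have "22981 * x ^ 3 \<le> 45962 * x * S"
    using mult_left_mono[OF S(1), of x] x by (simp add: power3_eq_cube power2_eq_square mult_ac)
  moreover have "n * Re \<theta> = S * n\<^sup>2 / 2 * Re (\<theta>\<^sup>2) - Re (G \<theta>)"
  proof -
    have "n * \<theta> = 2 * pi * \<i> + of_real (S * n\<^sup>2 / 2) * \<theta>\<^sup>2 - G \<theta>"
      using fix1 n by (simp add: G_def S_def)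
    then have "Re (n * \<theta>) = Re (2 * pi * \<i> + of_real (S * n\<^sup>2 / 2) * \<theta>\<^sup>2 - G \<theta>)" by simp
    then show ?thesis by simp
  qed
  moreover have "\<bar>Re (G \<theta>)\<bar> \<le> 22981 * x ^ 3"
    using abs_Re_le_cmod[of "G \<theta>"] G[OF \<theta>(1)] by linarith
  moreover have "0 \<le> x * S" using x S by simp
  ultimately have "\<bar>n * Re \<theta> + 2 * pi\<^sup>2 * S\<bar> \<le> 60000 * (x * S)" using 1 by linarith
  then show ?thesis using that eq norm7[OF \<theta>(1)] by (simp add: x_def)
qed

section \<open>Wilson's method\<close>

text \<open>
  Wilson's method. The drift hypothesis, for all centres \<open>c\<close>, expresses that \<open>\<Phi>\<close> is multiplied by \<open>\<zeta>\<close> in mean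
  and that the conditional variance of a step is at most \<open>R\<close>. Hence the variance of \<open>\<Phi>\<close>, at every time and in
  equilibrium, is at most \<open>V = R / (1 - \<bar>\<zeta>\<bar>\<^sup>2)\<close>, while its mean is \<open>M = \<bar>\<zeta>\<bar> ^ t \<bar>\<Phi> s\<bar>\<close> in modulus at time \<open>t\<close> and
  \<open>0\<close> in equilibrium. By Chebyshev's inequality the event \<open>\<bar>\<Phi>\<bar> \<ge> M / 2\<close> tells the two distributions apart
  up to an error \<open>8 V / M\<^sup>2\<close>, so closeness within \<open>1 / 4\<close> forces \<open>M\<^sup>2 \<le> 32 V / 3\<close>.
\<close>

lemma wilson_bound:
  fixes \<Phi> :: "nat list \<Rightarrow> complex"
  assumes k: "1 \<le> k" "k \<le> n" and s: "s \<in> decks n" and \<zeta>: "norm \<zeta> < 1"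
    and step: "\<And>xs c. xs \<in> decks n \<Longrightarrow> measure_pmf.expectation (shuffle_step n k xs) (\<lambda>ys. (norm (\<Phi> ys - c))\<^sup>2)
        \<le> (norm (\<zeta> * \<Phi> xs - c))\<^sup>2 + R"
    and tv: "tv_dist (decks n) (shuffle_law n k s t) (pmf_of_set (decks n)) \<le> 1 / 4"
  shows "(norm \<zeta> ^ t * norm (\<Phi> s))\<^sup>2 * (1 - (norm \<zeta>)\<^sup>2) \<le> 11 * R"
proof -
  let ?u = "pmf_of_set (decks n)" and ?E = "measure_pmf.expectation"
  define \<mu> where "\<mu> t = shuffle_law n k s t" for t
  have sub: "set_pmf (\<mu> t) \<subseteq> decks n" for t
    unfolding \<mu>_def using set_pmf_law_subset[OF k s] .
  have fin: "finite (set_pmf (shuffle_step n k xs))" for xs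
    using set_pmf_shuffle_step[OF k] by simp
  have finu: "finite (set_pmf ?u)" by simp
  have fin\<mu>: "finite (set_pmf (\<mu> t))" for t
    using finite_subset[OF sub] by simp
  define q where "q = 1 - (norm \<zeta>)\<^sup>2"
  have q: "0 < q" using \<zeta> by (simp add: q_def power_less_one_iff abs_square_less_1)
  have "0 \<le> ?E (shuffle_step n k s) (\<lambda>ys. (norm (\<Phi> ys - \<zeta> * \<Phi> s))\<^sup>2)"
    by (intro integral_nonneg_AE) simp
  also have "\<dots> \<le> R" using step[OF s, of "\<zeta> * \<Phi> s"] by simp
  finally have R: "0 \<le> R" .
  \<comment> \<open>In equilibrium the second moments before and after a step coincide.\<close>
  have u: "?E ?u (\<lambda>xs. (norm (\<Phi> xs))\<^sup>2) * q \<le> R"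
  proof -
    have "?E (bind_pmf ?u (shuffle_step n k)) (\<lambda>xs. (norm (\<Phi> xs))\<^sup>2)
        \<le> (norm \<zeta>)\<^sup>2 * ?E ?u (\<lambda>xs. (norm (\<Phi> xs))\<^sup>2) + R"
      by (rule expectation_bind_le[of "decks n"])
         (use step[of _ 0] fin in \<open>auto simp: norm_mult power_mult_distrib\<close>)
    then show ?thesis
      unfolding uniform_stationary_step[OF k] by (simp add: q_def algebra_simps)
  qed
  have var: "?E (\<mu> t) (\<lambda>xs. (norm (\<Phi> xs - \<zeta> ^ t * \<Phi> s))\<^sup>2) * q \<le> R"
  proof (induction t)
    case 0
    then show ?case using R by (simp add: \<mu>_def)
  next
    case (Suc t)
    have "?E (\<mu> (Suc t)) (\<lambda>xs. (norm (\<Phi> xs - \<zeta> ^ Suc t * \<Phi> s))\<^sup>2)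
        \<le> (norm \<zeta>)\<^sup>2 * ?E (\<mu> t) (\<lambda>xs. (norm (\<Phi> xs - \<zeta> ^ t * \<Phi> s))\<^sup>2) + R"
      unfolding \<mu>_def shuffle_law.simps
    proof (rule expectation_bind_le[OF finite_decks sub[unfolded \<mu>_def] fin])
      fix xs assume xs: "xs \<in> decks n"
      have "\<zeta> * \<Phi> xs - \<zeta> ^ Suc t * \<Phi> s = \<zeta> * (\<Phi> xs - \<zeta> ^ t * \<Phi> s)" by (simp add: algebra_simps)
      then show "?E (shuffle_step n k xs) (\<lambda>ys. (norm (\<Phi> ys - \<zeta> ^ Suc t * \<Phi> s))\<^sup>2)
          \<le> (norm \<zeta>)\<^sup>2 * (norm (\<Phi> xs - \<zeta> ^ t * \<Phi> s))\<^sup>2 + R"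
        using step[OF xs, of "\<zeta> ^ Suc t * \<Phi> s"] by (simp only: norm_mult power_mult_distrib)
    qed
    then have "?E (\<mu> (Suc t)) (\<lambda>xs. (norm (\<Phi> xs - \<zeta> ^ Suc t * \<Phi> s))\<^sup>2) * q
        \<le> ((norm \<zeta>)\<^sup>2 * ?E (\<mu> t) (\<lambda>xs. (norm (\<Phi> xs - \<zeta> ^ t * \<Phi> s))\<^sup>2) + R) * q"
      using q by (intro mult_right_mono) auto
    also have "\<dots> = (norm \<zeta>)\<^sup>2 * (?E (\<mu> t) (\<lambda>xs. (norm (\<Phi> xs - \<zeta> ^ t * \<Phi> s))\<^sup>2) * q) + R * q"
      by (simp add: algebra_simps)
    also have "\<dots> \<le> (norm \<zeta>)\<^sup>2 * R + R * q"
      using Suc.IH by (intro add_right_mono mult_left_mono) auto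
    also have "\<dots> = R" by (simp add: q_def algebra_simps)
    finally show ?case .
  qed
  define M where "M = norm (\<zeta> ^ t * \<Phi> s)"
  show ?thesis
  proof (cases "M = 0")
    case True
    then have "norm \<zeta> ^ t * norm (\<Phi> s) = 0" by (simp add: M_def norm_mult norm_power)
    then show ?thesis using R by (simp only:) simp
  next
    case False
    then have M: "0 < M" by (simp add: M_def)
    have M2: "0 < (M / 2)\<^sup>2" using M by simp
    let ?A = "{xs. (M / 2)\<^sup>2 \<le> (norm (\<Phi> xs))\<^sup>2}"
    have "measure_pmf.prob ?u ?A \<le> ?E ?u (\<lambda>xs. (norm (\<Phi> xs))\<^sup>2) / (M / 2)\<^sup>2"
      by (rule prob_markov[OF finu _ M2]) simp
    also have "\<dots> \<le> (R / q) / (M / 2)\<^sup>2"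
      using u q by (intro divide_right_mono) (auto simp: pos_le_divide_eq)
    finally have 1: "measure_pmf.prob ?u ?A \<le> (R / q) / (M / 2)\<^sup>2" .
    have "- ?A \<subseteq> {xs. (M / 2)\<^sup>2 \<le> (norm (\<Phi> xs - \<zeta> ^ t * \<Phi> s))\<^sup>2}"
    proof
      fix xs assume "xs \<in> - ?A"
      then have "\<not> (M / 2)\<^sup>2 \<le> (norm (\<Phi> xs))\<^sup>2" by simp
      then have "norm (\<Phi> xs) < M / 2"
        using power_mono[of "M / 2" "norm (\<Phi> xs)" 2] M by fastforce
      moreover have "M \<le> norm (\<Phi> xs) + norm (\<Phi> xs - \<zeta> ^ t * \<Phi> s)"
        unfolding M_def using norm_triangle_sub[of "\<zeta> ^ t * \<Phi> s" "\<Phi> xs"]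
        by (simp add: norm_minus_commute)
      ultimately have "M / 2 \<le> norm (\<Phi> xs - \<zeta> ^ t * \<Phi> s)" by linarith
      then show "xs \<in> {xs. (M / 2)\<^sup>2 \<le> (norm (\<Phi> xs - \<zeta> ^ t * \<Phi> s))\<^sup>2}"
        using M by (simp add: power_mono)
    qed
    then have "measure_pmf.prob (\<mu> t) (- ?A) \<le> measure_pmf.prob (\<mu> t) {xs. (M / 2)\<^sup>2 \<le> (norm (\<Phi> xs - \<zeta> ^ t * \<Phi> s))\<^sup>2}"
      by (intro measure_pmf.finite_measure_mono) auto
    also have "\<dots> \<le> ?E (\<mu> t) (\<lambda>xs. (norm (\<Phi> xs - \<zeta> ^ t * \<Phi> s))\<^sup>2) / (M / 2)\<^sup>2"
      by (rule prob_markov[OF fin\<mu> _ M2]) simp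
    also have "\<dots> \<le> (R / q) / (M / 2)\<^sup>2"
      using var q by (intro divide_right_mono) (auto simp: pos_le_divide_eq)
    finally have 2: "measure_pmf.prob (\<mu> t) (- ?A) \<le> (R / q) / (M / 2)\<^sup>2" .
    have "measure_pmf.prob (\<mu> t) (- ?A) = 1 - measure_pmf.prob (\<mu> t) ?A"
      using measure_pmf.prob_compl[of ?A "\<mu> t"] by (simp add: Compl_eq_Diff_UNIV)
    moreover have "measure_pmf.prob (\<mu> t) ?A - measure_pmf.prob ?u ?A \<le> 1 / 4"
      using tv_prob_le[OF finite_decks sub, of ?u t ?A] tv by (simp add: \<mu>_def)
    ultimately have "3 / 4 \<le> 2 * ((R / q) / (M / 2)\<^sup>2)" using 1 2 by linarith
    also have "\<dots> = 8 * R / (q * M\<^sup>2)" by (simp add: power_divide)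
    finally have "3 / 4 * (q * M\<^sup>2) \<le> 8 * R"
      using pos_le_divide_eq[of "q * M\<^sup>2" "3 / 4" "8 * R"] q M by simp
    then have "M\<^sup>2 * q \<le> 11 * R" using R by (simp add: mult.commute)
    then show ?thesis by (simp add: M_def q_def norm_mult norm_power)
  qed
qed

text \<open>
  Centred noise is orthogonal to any constant, and centring does not increase its second moment.
\<close>

lemma sum_norm_centered_le:
  fixes u :: "'i \<Rightarrow> 'a::real_inner"
  assumes "(\<Sum>i\<in>I. u i) = real (card I) *\<^sub>R m"
  shows "(\<Sum>i\<in>I. (norm (z - m + u i))\<^sup>2) \<le> card I * (norm z)\<^sup>2 + (\<Sum>i\<in>I. (norm (u i))\<^sup>2)"
proof -
  have "(norm (z - m + u i))\<^sup>2 = (norm (z - m))\<^sup>2 + 2 * inner (z - m) (u i) + (norm (u i))\<^sup>2" for i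
    by (simp add: power2_norm_eq_inner inner_add_left inner_add_right inner_commute)
  then have "(\<Sum>i\<in>I. (norm (z - m + u i))\<^sup>2)
      = card I * (norm (z - m))\<^sup>2 + 2 * inner (z - m) (\<Sum>i\<in>I. u i) + (\<Sum>i\<in>I. (norm (u i))\<^sup>2)"
    by (simp add: sum.distrib inner_sum_right sum_distrib_left)
  also have "\<dots> = card I * ((norm z)\<^sup>2 - (norm m)\<^sup>2) + (\<Sum>i\<in>I. (norm (u i))\<^sup>2)"
    unfolding assms
    by (simp add: power2_norm_eq_inner inner_diff_left inner_diff_right inner_commute algebra_simps)
  also have "\<dots> \<le> card I * (norm z)\<^sup>2 + (\<Sum>i\<in>I. (norm (u i))\<^sup>2)"
    by (intro add_right_mono mult_left_mono) auto
  finally show ?thesis .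
qed

lemma sum_nth_append:
  "(\<Sum>l<length (as @ bs). F ((as @ bs) ! l) l)
    = (\<Sum>l<length as. F (as ! l) l) + (\<Sum>l<length bs. F (bs ! l) (length as + l))"
  for F :: "'a \<Rightarrow> nat \<Rightarrow> 'b::comm_monoid_add"
proof (induction bs rule: rev_induct)
  case (snoc b bs)
  have *: "(\<Sum>l<length as + length bs. F ((as @ bs @ [b]) ! l) l)
      = (\<Sum>l<length (as @ bs). F ((as @ bs) ! l) l)"
    by (intro sum.cong) (auto simp: nth_append)
  have **: "(\<Sum>l<length bs. F ((bs @ [b]) ! l) (length as + l)) = (\<Sum>l<length bs. F (bs ! l) (length as + l))"
    by (intro sum.cong) (auto simp: nth_append)
  show ?case using snoc.IH * ** by (simp add: nth_append ac_simps)
qed (simp add: nth_append)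

text \<open>
  Following the cards instead of the positions: the card at index \<open>l\<close> goes to the index on the right.
\<close>

lemma sum_nth_move_to_top:
  fixes F :: "'a \<Rightarrow> nat \<Rightarrow> 'b::comm_monoid_add"
  assumes "length xs = n" "j < n"
  shows "(\<Sum>l<n. F (move_to_top (Suc j) xs ! l) l)
    = (\<Sum>l<n. F (xs ! l) (if l < j then Suc l else if l = j then 0 else l))"
proof -
  obtain as x bs where xs: "xs = as @ x # bs" and j: "Suc j = Suc (length as)"
    using split_at[of "Suc j" xs] assms by auto
  have n: "n = length (as @ x # bs)" "n = length (x # as @ bs)" using assms xs by auto
  let ?\<sigma> = "\<lambda>l. if l < j then Suc l else if l = j then 0 else l"
  have cons: "(\<Sum>l<length (y # ys). G ((y # ys) ! l) l) = G y 0 + (\<Sum>l<length ys. G (ys ! l) (Suc l))"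
    for y ys and G :: "'a \<Rightarrow> nat \<Rightarrow> 'b"
    by (simp only: length_Cons sum.lessThan_Suc_shift) simp
  have "(\<Sum>l<n. F (move_to_top (Suc j) xs ! l) l) = F x 0
      + ((\<Sum>l<length as. F (as ! l) (Suc l)) + (\<Sum>l<length bs. F (bs ! l) (Suc (length as + l))))"
    unfolding xs j move_to_top_Cons n(2) cons
    using sum_nth_append[of "\<lambda>y l. F y (Suc l)" as bs] by simp
  moreover have "(\<Sum>l<n. F (xs ! l) (?\<sigma> l))
      = (\<Sum>l<length as. F (as ! l) (?\<sigma> l)) + (\<Sum>l<length (x # bs). F ((x # bs) ! l) (?\<sigma> (length as + l)))"
    unfolding xs n(1) by (rule sum_nth_append[of "\<lambda>y l. F y (?\<sigma> l)"])
  moreover have "(\<Sum>l<length (x # bs). F ((x # bs) ! l) (?\<sigma> (length as + l)))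
      = F x 0 + (\<Sum>l<length bs. F (bs ! l) (Suc (length as + l)))"
    unfolding cons[of "\<lambda>y l. F y (?\<sigma> (length as + l))"] using j by simp
  moreover have "(\<Sum>l<length as. F (as ! l) (?\<sigma> l)) = (\<Sum>l<length as. F (as ! l) (Suc l))"
    using j by (intro sum.cong) auto
  ultimately show ?thesis by (simp add: ac_simps)
qed

text \<open>
  The weight is constant on the bottom \<open>k\<close> positions because the chance of a card there to be chosen does not
  depend on its place.
\<close>

definition wave :: "nat \<Rightarrow> nat \<Rightarrow> complex \<Rightarrow> (nat \<Rightarrow> complex) \<Rightarrow> nat list \<Rightarrow> complex" where
  "wave n k \<zeta> a xs = (\<Sum>l<n. a (xs ! l) * \<zeta> ^ min l (n - k))"

text \<open>
  Every card contributes \<open>\<zeta>\<close> times its old weight except those in the bottom part, which keep their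
  weight \<open>\<zeta> ^ (n - k)\<close>, and the chosen one, whose weight becomes \<open>1\<close>.
\<close>

lemma wave_move_to_top:
  assumes xs: "length xs = n" and j: "n - k \<le> j" "j < n"
  shows "wave n k \<zeta> a (move_to_top (Suc j) xs) = \<zeta> * wave n k \<zeta> a xs
    + \<zeta> ^ (n - k) * (1 - \<zeta>) * (\<Sum>l\<in>{n - k..<n}. a (xs ! l)) + a (xs ! j) * (1 - \<zeta> ^ (n - k))"
proof -
  define m where "m = n - k"
  let ?\<sigma> = "\<lambda>l. if l < j then Suc l else if l = j then 0 else l"
  have weight: "\<zeta> ^ min (?\<sigma> l) m = \<zeta> * \<zeta> ^ min l m
      + (if l \<in> {m..<n} then \<zeta> ^ m * (1 - \<zeta>) else 0) + (if l = j then 1 - \<zeta> ^ m else 0)"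
    if "l < n" for l
  proof -
    have "m \<le> j" using j by (simp add: m_def)
    consider "l < m" | "m \<le> l" "l < j" | "l = j" | "j < l" by linarith
    then show ?thesis
    proof cases
      case 1
      then show ?thesis using that \<open>m \<le> j\<close> by (simp add: min_def)
    qed (use that \<open>m \<le> j\<close> in \<open>auto simp: min_def algebra_simps\<close>)
  qed
  have "wave n k \<zeta> a (move_to_top (Suc j) xs) = (\<Sum>l<n. a (xs ! l) * \<zeta> ^ min (?\<sigma> l) m)"
    unfolding wave_def m_def[symmetric] using sum_nth_move_to_top[OF xs j(2), of "\<lambda>c l. a c * \<zeta> ^ min l m"] .
  also have "\<dots> = (\<Sum>l<n. \<zeta> * (a (xs ! l) * \<zeta> ^ min l m)
      + (if l \<in> {m..<n} then \<zeta> ^ m * (1 - \<zeta>) * a (xs ! l) else 0)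
      + (if l = j then a (xs ! l) * (1 - \<zeta> ^ m) else 0))"
    by (intro sum.cong refl) (simp add: weight algebra_simps del: if_split split: if_splits)
  also have "\<dots> = \<zeta> * wave n k \<zeta> a xs
      + (\<Sum>l\<in>{..<n} \<inter> {m..<n}. \<zeta> ^ m * (1 - \<zeta>) * a (xs ! l)) + a (xs ! j) * (1 - \<zeta> ^ m)"
    using j by (simp only: sum.distrib sum.inter_restrict[OF finite_lessThan] sum.delta[OF finite_lessThan])
       (simp add: wave_def m_def sum_distrib_left)
  also have "{..<n} \<inter> {m..<n} = {m..<n}" by auto
  finally show ?thesis by (simp add: m_def sum_distrib_left)
qed

text \<open>
  The last two terms of \<open>wave_move_to_top\<close> are the step noise: the equation for \<open>\<zeta>\<close> says precisely that they
  cancel in the mean over the \<open>k\<close> choices. Only the weight of the chosen card fluctuates, so the variance is at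
  most \<open>\<bar>1 - \<zeta> ^ (n - k)\<bar>\<^sup>2\<close>, with no factor counting the cards.
\<close>

lemma wave_step:
  assumes k: "1 \<le> k" "k \<le> n" and xs: "xs \<in> decks n"
    and eig: "\<zeta> ^ (n - k) * (1 + of_nat k * (\<zeta> - 1)) = 1" and a: "\<And>c. norm (a c) \<le> 1"
  shows "measure_pmf.expectation (shuffle_step n k xs) (\<lambda>ys. (norm (wave n k \<zeta> a ys - c))\<^sup>2)
    \<le> (norm (\<zeta> * wave n k \<zeta> a xs - c))\<^sup>2 + (norm (1 - \<zeta> ^ (n - k)))\<^sup>2"
proof -
  let ?\<Phi> = "wave n k \<zeta> a" and ?I = "{n - k + 1..n}"
  define p where "p = \<zeta> ^ (n - k)"
  define B where "B = (\<Sum>l\<in>{n - k..<n}. a (xs ! l))"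
  define m where "m = B * (1 - p) / of_nat k"
  define u where "u i = a (xs ! (i - 1)) * (1 - p)" for i
  have k0: "of_nat k \<noteq> (0 :: complex)" using k by simp
  have "1 - p = of_nat k * (p * (\<zeta> - 1))" using eig by (simp add: p_def algebra_simps)
  then have "m = B * (p * (\<zeta> - 1))" using k0 by (simp add: m_def)
  then have m: "p * (1 - \<zeta>) * B = - m" by (simp add: algebra_simps)
  have move: "?\<Phi> (move_to_top i xs) - c = (\<zeta> * ?\<Phi> xs - c) - m + u i" if "i \<in> ?I" for i
  proof -
    have "?\<Phi> (move_to_top (Suc (i - 1)) xs) = \<zeta> * ?\<Phi> xs + p * (1 - \<zeta>) * B + u i"
      unfolding p_def B_def u_def
      using that k by (intro wave_move_to_top length_decks[OF xs]) auto
    then show ?thesis using that m by simp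
  qed
  have card: "card ?I = k" using k by simp
  have "(\<Sum>i\<in>?I. u i) = B * (1 - p)"
  proof -
    have "(\<Sum>i\<in>?I. u i) = (\<Sum>l\<in>{n - k..<n}. u (Suc l))"
      by (rule sum.reindex_bij_witness[of _ Suc "\<lambda>i. i - 1"]) auto
    then show ?thesis by (simp add: u_def B_def sum_distrib_right)
  qed
  then have sum_u: "(\<Sum>i\<in>?I. u i) = real (card ?I) *\<^sub>R m"
    using k0 by (simp only: card) (simp add: m_def scaleR_conv_of_real)
  have "(\<Sum>i\<in>?I. (norm (?\<Phi> (move_to_top i xs) - c))\<^sup>2) = (\<Sum>i\<in>?I. (norm ((\<zeta> * ?\<Phi> xs - c) - m + u i))\<^sup>2)"
    by (intro sum.cong refl) (simp only: move)
  also have "\<dots> \<le> card ?I * (norm (\<zeta> * ?\<Phi> xs - c))\<^sup>2 + (\<Sum>i\<in>?I. (norm (u i))\<^sup>2)"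
    by (rule sum_norm_centered_le[OF sum_u])
  also have "(\<Sum>i\<in>?I. (norm (u i))\<^sup>2) \<le> (\<Sum>i\<in>?I. (norm (1 - p))\<^sup>2)"
    using a by (intro sum_mono power_mono) (auto simp: u_def norm_mult mult_left_le_one_le)
  finally have "(\<Sum>i\<in>?I. (norm (?\<Phi> (move_to_top i xs) - c))\<^sup>2)
      \<le> ((norm (\<zeta> * ?\<Phi> xs - c))\<^sup>2 + (norm (1 - p))\<^sup>2) * k"
    by (simp only: sum_constant card) (simp add: algebra_simps)
  then show ?thesis
    using k by (simp add: expectation_shuffle_step[OF k] pos_divide_le_eq p_def)
qed

text \<open>
  With the conjugate phases as coefficients all terms of the sum are positive in the sorted deck.
\<close>

lemma wave_initial:
  fixes \<zeta> :: complex and n k :: nat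
  assumes \<zeta>: "\<zeta> \<noteq> 0" "norm \<zeta> \<le> 1"
  defines "a \<equiv> \<lambda>c. cnj (sgn (\<zeta> ^ min (c - 1) (n - k)))"
  shows "norm (a c) \<le> 1" and "real n * norm \<zeta> ^ n \<le> norm (wave n k \<zeta> a [1..<Suc n])"
proof -
  show "norm (a c) \<le> 1" by (simp add: a_def norm_sgn)
  have "wave n k \<zeta> a [1..<Suc n] = (\<Sum>l<n. of_real (norm \<zeta> ^ min l (n - k)))"
    unfolding wave_def
  proof (intro sum.cong refl)
    fix l assume "l \<in> {..<n}"
    then have "a ([1..<Suc n] ! l) = cnj (sgn (\<zeta> ^ min l (n - k)))"
      by (simp add: a_def del: upt_Suc)
    moreover have "cnj (sgn z) * z = of_real (norm z)" for z :: complex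
      by (cases "z = 0") (simp_all add: sgn_div_norm scaleR_conv_of_real complex_norm_square[symmetric]
          mult.commute[of "cnj z"] mult.assoc power2_eq_square field_simps)
    ultimately show "a ([1..<Suc n] ! l) * \<zeta> ^ min l (n - k) = of_real (norm \<zeta> ^ min l (n - k))"
      by (simp add: norm_power)
  qed
  also have "\<dots> = of_real (\<Sum>l<n. norm \<zeta> ^ min l (n - k))" by simp
  finally have "norm (wave n k \<zeta> a [1..<Suc n]) = (\<Sum>l<n. norm \<zeta> ^ min l (n - k))"
    by (simp only: norm_of_real) (simp add: sum_nonneg)
  moreover have "(\<Sum>l<n. norm \<zeta> ^ n) \<le> (\<Sum>l<n. norm \<zeta> ^ min l (n - k))"
    using \<zeta> by (intro sum_mono power_decreasing) auto
  ultimately show "real n * norm \<zeta> ^ n \<le> norm (wave n k \<zeta> a [1..<Suc n])" by simp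
qed

text \<open>
  With \<open>q = - ln \<bar>\<zeta>\<bar>\<close> and \<open>S = k (k - 1) / n\<^sup>2\<close>, both the step noise \<open>R\<close> (as \<open>\<bar>\<zeta> - 1\<bar>\<close> is of order \<open>1 / n\<close>) and
  \<open>n (1 - \<bar>\<zeta>\<bar>\<^sup>2)\<close> are of order \<open>S\<close>, so that \<open>V\<close> is of order \<open>n\<close> uniformly in \<open>k\<close>. As \<open>\<bar>\<Phi> s\<bar> \<ge> n / 2\<close>, Wilson's bound
  becomes \<open>exp (- 2 q t) n \<le> 1500\<close>, and \<open>2 q\<close> is \<open>4 \<pi>\<^sup>2 S / n\<close> up to a factor \<open>1 + O(k / n)\<close>.
\<close>

lemma mixing_time_ge_cubic:
  assumes k: "2 \<le> k" and kn: "10000 * k \<le> n" and n: "1500 \<le> n"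
  shows "(ln n - ln 1500) / (1 + 4000 * (k / n)) * (real n ^ 3 / (4 * pi\<^sup>2 * k * (real k - 1)))
    \<le> mixing_time n k"
proof -
  define x S where "x = real k / n" and "S = real k * (real k - 1) / (real n)\<^sup>2"
  have n0: "0 < real n" using n by simp
  have k1: "1 \<le> k" "k \<le> n" using k kn by auto
  have x: "0 \<le> x" "x \<le> 1 / 10000" using kn n0 by (auto simp: x_def field_simps)
  have S: "x\<^sup>2 / 2 \<le> S" "S \<le> x\<^sup>2" "0 < S"
    using k n0 by (auto simp: S_def x_def power_divide power2_eq_square field_simps)
  obtain \<theta> :: complex where eig: "exp (of_nat (n - k) * \<theta>) * (1 + of_nat k * (exp \<theta> - 1)) = 1"
    and \<theta>: "norm \<theta> \<le> 7 / n" and re: "\<bar>n * Re \<theta> + 2 * pi\<^sup>2 * S\<bar> \<le> 60000 * x * S"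
    using eigenvalue_exists[OF k kn] unfolding x_def S_def by blast
  define \<zeta> q where "\<zeta> = exp \<theta>" and "q = - Re \<theta>"
  have \<zeta>q: "norm \<zeta> = exp (- q)" by (simp add: \<zeta>_def q_def)
  have eig': "\<zeta> ^ (n - k) * (1 + of_nat k * (\<zeta> - 1)) = 1"
    using eig by (simp add: \<zeta>_def exp_of_nat_mult)
  have pi2: "9 \<le> pi\<^sup>2" "pi\<^sup>2 \<le> 10"
    using power_mono[of 3 pi 2] power_mono[of pi "63 / 20" 2] pi_bounds
    by (auto simp: power_divide)
  have xS: "60000 * x * S \<le> 6 * S" using x S by (intro mult_right_mono) auto
  have piS: "9 * S \<le> pi\<^sup>2 * S" "pi\<^sup>2 * S \<le> 10 * S" using pi2 S by (auto intro!: mult_right_mono)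
  have nq: "12 * S \<le> n * q" "n * q \<le> 26 * S" "n * q \<le> 2 * pi\<^sup>2 * S + 60000 * x * S"
  proof -
    have "n * q = - (n * Re \<theta>)" by (simp add: q_def)
    then show "12 * S \<le> n * q" "n * q \<le> 26 * S" "n * q \<le> 2 * pi\<^sup>2 * S + 60000 * x * S"
      using re xS piS by linarith+
  qed
  have x2: "x\<^sup>2 \<le> 1 / 100000000" using power_mono[OF x(2) x(1), of 2] by (simp add: power2_eq_square)
  have nq': "n * q \<le> 1 / 2" using nq S x2 by linarith
  have q0: "0 < q" using nq(1) S n0 by (metis mult_pos_pos order_less_le_trans zero_less_mult_pos zero_less_numeral)
  have "q * 1500 \<le> q * n" using q0 n by (intro mult_left_mono) auto
  then have q1: "q \<le> 1 / 2" using nq' q0 mult.commute[of q n] by linarith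
  have \<zeta>1: "norm \<zeta> < 1" "\<zeta> \<noteq> 0" using q0 \<zeta>q by (auto simp: \<zeta>_def)
  \<comment> \<open>For \<open>0 \<le> q \<le> 1 / 2\<close> one has \<open>exp (- 2 q) \<le> 1 / (1 + 2 q) \<le> 1 - q\<close>.\<close>
  have gap: "q \<le> 1 - (norm \<zeta>)\<^sup>2"
  proof -
    have "(norm \<zeta>)\<^sup>2 = 1 / exp (2 * q)" by (simp add: \<zeta>q exp_minus inverse_eq_divide power_divide flip: exp_double)
    also have "\<dots> \<le> 1 / (1 + 2 * q)" using exp_ge_add_one_self[of "2 * q"] q0 by (intro divide_left_mono) auto
    also have "\<dots> \<le> 1 - q"
    proof -
      have "q * q \<le> q * (1 / 2)" using q0 q1 by (intro mult_left_mono) auto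
      then have "1 \<le> (1 - q) * (1 + 2 * q)" by (simp add: algebra_simps)
      then show ?thesis using q0 by (simp add: pos_divide_le_eq)
    qed
    finally show ?thesis by simp
  qed
  \<comment> \<open>The eigenvalue equation turns \<open>1 - \<zeta> ^ (n - k)\<close> into a multiple of \<open>k (\<zeta> - 1)\<close>, which is of order \<open>k / n\<close>.\<close>
  have noise: "(norm (1 - \<zeta> ^ (n - k)))\<^sup>2 \<le> 392 * S"
  proof -
    have "norm (exp \<theta> - (\<Sum>i\<le>0. \<theta> ^ i / fact i)) \<le> exp (norm \<theta>) * norm \<theta> ^ Suc 0 / fact 0"
      by (rule Taylor_exp_field)
    then have "norm (\<zeta> - 1) \<le> exp (norm \<theta>) * norm \<theta>" by (simp add: \<zeta>_def)
    also have "\<dots> \<le> 2 * (7 / n)"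
    proof (rule mult_mono)
      have "7 / n \<le> 1 / 2" using n by (simp add: field_simps)
      then show "exp (norm \<theta>) \<le> 2" using exp_bound_half[of "norm \<theta>"] \<theta> by simp
    qed (use \<theta> in auto)
    finally have l1: "norm (\<zeta> - 1) \<le> 14 / n" by simp
    have "1 - \<zeta> ^ (n - k) = \<zeta> ^ (n - k) * (of_nat k * (\<zeta> - 1))" using eig' by (simp add: algebra_simps)
    then have "norm (1 - \<zeta> ^ (n - k)) = norm \<zeta> ^ (n - k) * (k * norm (\<zeta> - 1))"
      by (simp add: norm_mult norm_power)
    also have "\<dots> \<le> 1 * (k * (14 / n))"
      using \<zeta>1 l1 by (intro mult_mono power_le_one mult_left_mono) auto
    finally have "norm (1 - \<zeta> ^ (n - k)) \<le> 14 * x" by (simp add: x_def mult.commute)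
    then have "(norm (1 - \<zeta> ^ (n - k)))\<^sup>2 \<le> (14 * x)\<^sup>2" by (intro power_mono) auto
    then show ?thesis using S by (simp add: power_mult_distrib)
  qed
  define a where "a = (\<lambda>c. cnj (sgn (\<zeta> ^ min (c - 1) (n - k))))"
  let ?s = "[1..<Suc n]"
  have s: "?s \<in> decks n" by (auto simp: decks_iff)
  have a: "norm (a c) \<le> 1" for c
    unfolding a_def by (rule wave_initial(1)[OF \<zeta>1(2) less_imp_le[OF \<zeta>1(1)]])
  have init: "real n * norm \<zeta> ^ n \<le> norm (wave n k \<zeta> a ?s)"
    unfolding a_def by (rule wave_initial(2)[OF \<zeta>1(2) less_imp_le[OF \<zeta>1(1)]])
  have "1 / 2 \<le> norm \<zeta> ^ n"
  proof -
    have "1 / 2 \<le> 1 + - (n * q)" using nq' by simp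
    also have "\<dots> \<le> exp (- (n * q))" by (rule exp_ge_add_one_self)
    also have "\<dots> = norm \<zeta> ^ n" by (simp add: \<zeta>q flip: exp_of_nat_mult)
    finally show ?thesis .
  qed
  then have init': "n / 2 \<le> norm (wave n k \<zeta> a ?s)"
    using init mult_left_mono[of "1 / 2" "norm \<zeta> ^ n" "real n"] by simp
  have "(ln n - ln 1500) / (2 * q) \<le> mixing_time n k"
  proof (rule mixing_time_ge[OF k k1(2) s])
    fix t assume tv: "tv_dist (decks n) (shuffle_law n k ?s t) (pmf_of_set (decks n)) \<le> 1 / 4"
    have "(norm \<zeta> ^ t * (n / 2))\<^sup>2 * q
        \<le> (norm \<zeta> ^ t * norm (wave n k \<zeta> a ?s))\<^sup>2 * (1 - (norm \<zeta>)\<^sup>2)"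
      using gap q0 init' by (intro mult_mono power_mono mult_left_mono) auto
    also have "\<dots> \<le> 11 * (norm (1 - \<zeta> ^ (n - k)))\<^sup>2"
      by (rule wilson_bound[OF k1 s \<zeta>1(1) _ tv]) (rule wave_step[OF k1 _ eig' a])
    also have "\<dots> \<le> 4312 * S" using noise by simp
    finally have le: "(norm \<zeta> ^ t * (n / 2))\<^sup>2 * q \<le> 4312 * S" .
    have "exp (- (2 * q * t)) * n * (3 * S) = (norm \<zeta> ^ t * (n / 2))\<^sup>2 * (12 * S / n)"
    proof -
      have "(norm \<zeta> ^ t)\<^sup>2 = exp (- (2 * q * t))"
        by (simp add: \<zeta>q mult_ac flip: exp_of_nat_mult exp_double)
      then show ?thesis using n0 by (simp add: power_mult_distrib power_divide power2_eq_square)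
    qed
    also have "\<dots> \<le> (norm \<zeta> ^ t * (n / 2))\<^sup>2 * q"
      using nq(1) n0 by (intro mult_left_mono) (auto simp: pos_divide_le_eq mult.commute)
    \<comment> \<open>The constant \<open>1500\<close> is a round bound for \<open>4312 / 3\<close>.\<close>
    also have "\<dots> \<le> (1500 * 3) * S" using le S by linarith
    finally have "exp (- (2 * q * t)) * n \<le> 1500" using S by (simp add: mult.commute)
    then have "ln (exp (- (2 * q * t)) * n) \<le> ln 1500" using n0 by (intro ln_mono) auto
    then have "ln n - ln 1500 \<le> 2 * q * t" using n0 by (simp add: ln_mult)
    then show "(ln n - ln 1500) / (2 * q) \<le> t" using q0 by (simp add: pos_divide_le_eq mult_ac)
  qed
  moreover have "(ln n - ln 1500) / (1 + 4000 * (k / n)) * (real n ^ 3 / (4 * pi\<^sup>2 * k * (real k - 1)))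
      \<le> (ln n - ln 1500) / (2 * q)"
  proof -
    have "60000 * x * S \<le> 8000 * x * (pi\<^sup>2 * S)"
      using piS(1) mult_left_mono[OF piS(1), of "8000 * x"] x S by (simp add: mult_ac)
    then have "n * q \<le> 2 * pi\<^sup>2 * S * (1 + 4000 * x)" using nq(3) by (simp add: algebra_simps)
    then have "2 * q \<le> 4 * pi\<^sup>2 * S * (1 + 4000 * x) / n" using n0 by (simp add: pos_le_divide_eq mult_ac)
    then have "(ln n - ln 1500) / (4 * pi\<^sup>2 * S * (1 + 4000 * x) / n) \<le> (ln n - ln 1500) / (2 * q)"
      using q0 n by (intro frac_le) auto
    moreover have "(ln n - ln 1500) / (4 * pi\<^sup>2 * S * (1 + 4000 * x) / n)
      = (ln n - ln 1500) / (1 + 4000 * (k / n)) * (real n ^ 3 / (4 * pi\<^sup>2 * k * (real k - 1)))"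
      by (simp add: S_def x_def power2_eq_square power3_eq_cube)
    ultimately show ?thesis by simp
  qed
  ultimately show ?thesis by linarith
qed

section \<open>Asymptotic form\<close>

lemma mixing_time_asymptotic:
  fixes k :: "nat \<Rightarrow> nat"
  assumes k: "\<forall>\<^sub>F n in sequentially. 2 \<le> k n \<and> k n \<le> n"
    and small: "(\<lambda>n. real (k n)) \<in> o(\<lambda>n. real n)"
  shows "\<exists>\<epsilon>\<in>o(\<lambda>_. 1 :: real). \<forall>\<^sub>F n in sequentially.
    real (mixing_time n (k n)) \<ge>
      (1 + \<epsilon> n) * (real n ^ 3 / (4 * pi\<^sup>2 * real (k n) * (real (k n) - 1)) * ln (real n))"
proof
  define \<epsilon> where "\<epsilon> n = (1 - ln 1500 / ln n) / (1 + 4000 * (real (k n) / real n)) - 1" for n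
  have kn: "(\<lambda>n. real (k n) / real n) \<longlonglongrightarrow> 0"
    using small by (rule smalloD_tendsto)
  have "(\<lambda>n. ln 1500 / ln (real n)) \<longlonglongrightarrow> 0"
    by (rule real_tendsto_divide_at_top[OF tendsto_const filterlim_compose[OF ln_at_top filterlim_real_sequentially]])
  then have "\<epsilon> \<longlonglongrightarrow> (1 - 0) / (1 + 4000 * 0) - 1"
    unfolding \<epsilon>_def using kn by (intro tendsto_intros) auto
  then show "\<epsilon> \<in> o(\<lambda>_. 1)" by (intro smalloI_tendsto) auto
  have "\<forall>\<^sub>F n in sequentially. real (k n) / real n < 1 / 10000"
    using kn by (rule order_tendstoD) simp
  then show "\<forall>\<^sub>F n in sequentially. real (mixing_time n (k n)) \<ge>
      (1 + \<epsilon> n) * (real n ^ 3 / (4 * pi\<^sup>2 * real (k n) * (real (k n) - 1)) * ln (real n))"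
    using k eventually_ge_at_top[of 1500]
  proof eventually_elim
    case (elim n)
    have "real (10000 * k n) \<le> real n" using elim by (simp add: field_simps)
    then have "10000 * k n \<le> n" by (simp only: of_nat_le_iff)
    moreover have "(1 + \<epsilon> n) * (C * ln n) = (ln n - ln 1500) / (1 + 4000 * (k n / n)) * C" for C
    proof -
      have "0 < ln (real n)" using elim by simp
      then have *: "(1 - ln 1500 / ln n) * ln n = ln n - ln 1500" by (simp add: left_diff_distrib)
      have "(1 + \<epsilon> n) * (C * ln n) = ((1 - ln 1500 / ln n) * ln n) / (1 + 4000 * (k n / n)) * C"
        by (simp add: \<epsilon>_def)
      then show ?thesis unfolding * .
    qed
    ultimately show ?case using mixing_time_ge_cubic[of "k n" n] elim by simp
  qed
qed

lemma mixing_time_bigomega: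
  fixes k :: "nat \<Rightarrow> nat"
  assumes k: "\<forall>\<^sub>F n in sequentially. 2 \<le> k n \<and> k n \<le> n"
    and Theta: "(\<lambda>n. real (k n)) \<in> \<Theta>(\<lambda>n. real n)"
  shows "(\<lambda>n. real (mixing_time n (k n))) \<in> \<Omega>(\<lambda>n. real n * ln (real n))"
proof -
  from Theta have "(\<lambda>n. real (k n)) \<in> \<Omega>(\<lambda>n. real n)" by (rule bigthetaD2)
  then obtain c where c: "0 < c" "\<forall>\<^sub>F n in sequentially. c * norm (real n) \<le> norm (real (k n))"
    by (auto elim: landau_omega.bigE)
  have "\<forall>\<^sub>F n in sequentially. c / 2 * norm (real n * ln (real n)) \<le> norm (real (mixing_time n (k n)))"
    using k c(2) eventually_ge_at_top[of 64]
  proof eventually_elim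
    case (elim n)
    have "ln (8 ^ 2) \<le> ln (real n)" using elim by (intro ln_mono) auto
    then have "2 * ln 8 \<le> ln (real n)" using ln_realpow[of "8::real" 2] by simp
    moreover have "ln ((real n + 1) / 8) \<ge> ln (real n / 8)" using elim by (intro ln_mono) auto
    moreover have "ln (real n / 8) = ln (real n) - ln 8" using elim by (simp add: ln_div)
    ultimately have "ln (real n) / 2 \<le> ln ((real n + 1) / 8)" by linarith
    moreover have "0 \<le> ln (real n)" using elim by simp
    ultimately have "(c * real n) * (ln (real n) / 2) \<le> real (k n) * ln ((real n + 1) / 8)"
      using elim by (intro mult_mono) auto
    also have "\<dots> \<le> mixing_time n (k n)" using mixing_time_ge_k_log elim by blast
    finally show ?case using \<open>0 \<le> ln (real n)\<close> by simp
  qed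
  then show ?thesis using c(1) by (intro landau_omega.bigI[of "c / 2"]) auto
qed

theorem theorem4p4:
  fixes k :: "nat \<Rightarrow> nat"
  assumes "\<forall>\<^sub>F n in sequentially. 2 \<le> k n \<and> k n \<le> n"
  shows "((\<lambda>n. real (k n)) \<in> o(\<lambda>n. real n) \<longrightarrow>
           (\<exists>\<epsilon>\<in>o(\<lambda>_. 1 :: real). \<forall>\<^sub>F n in sequentially.
              real (mixing_time n (k n)) \<ge>
                (1 + \<epsilon> n) * (real n ^ 3 / (4 * pi\<^sup>2 * real (k n) * (real (k n) - 1)) * ln (real n))))
       \<and> ((\<lambda>n. real (k n)) \<in> \<Theta>(\<lambda>n. real n) \<longrightarrow>
           (\<lambda>n. real (mixing_time n (k n))) \<in> \<Omega>(\<lambda>n. real n * ln (real n)))"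
  using mixing_time_asymptotic[OF assms] mixing_time_bigomega[OF assms] by blast

end
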